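(* Let $F:\mathbb{R}^n\to\mathbb{R}^n$ be continuously differentiable and $q:\mathbb{R}^n\to(-\infty,\infty]$ closed proper convex. Let $\bar x$ be a solution of $0\in F(x)+\partial q(x)$. Assume that $\partial q$ is SCD semismooth* at $(\bar x,-F(\bar x))$ and that $F+\partial q$ is SCD regular around $(\bar x,0)$. Then for every pair $\underline\gamma,\bar\gamma$ with $0<\underline\gamma\le\bar\gamma$ there exists a neighborhood $\mathcal U$ of $\bar x$ such that for every starting point $x^{(0)}\in\mathcal U$ Algorithm B (described in the context) produces a sequence $\{x^{(k)}\}$ converging superlinearly to $\bar x$, provided that in every iteration step one chooses $\gamma^{(k)}\in[\underline\gamma,\bar\gamma]$.
   Context: Derivative notions. Let $\mathcal X$ be an $n$-dimensional real Hilbert space. $\mathbb Z_n$ is the metric space of $n$-dimensional subspaces of $\mathcal X\times\mathcal X$ with metric $\|\Pi_{L_1}-\Pi_{L_2}\|$ ($\Pi_L$ orthogonal projection). For $L\in\mathbb Z_n$, $L^*:=\{(-v^*;u^* )\mid(u^*;v^* )\in L^\perp\}$. For $\Phi:\mathcal X\rightrightarrows\mathcal X$ with closed graph, $\widehat{\mathcal S}^*_\Phi(x,y):=\{(T_{\operatorname{gph}\Phi}(x;y))^*\}$ if $(x;y)\in\operatorname{gph}\Phi$ and the contingent (Bouligand) cone $T_{\operatorname{gph}\Phi}(x;y)$ belongs to $\mathbb Z_n$, and $\widehat{\mathcal S}^*_\Phi(x,y):=\emptyset$ otherwise. $\mathcal S^*_\Phi(x,y):=\limsup_{(u;v)\to(x;y),\,(u;v)\in\operatorname{gph}\Phi}\widehat{\mathcal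 S}^*_\Phi(u,v)$ (all limits in $\mathbb Z_n$ of sequences $L_k\in\widehat{\mathcal S}^*_\Phi(u_k,v_k)$ with $(u_k;v_k)\to(x;y)$ in $\operatorname{gph}\Phi$). $\Phi$ has the SCD property around $(x,y)\in\operatorname{gph}\Phi$ if $\mathcal S^*_\Phi(x',y')\ne\emptyset$ for all $(x';y')\in\operatorname{gph}\Phi$ near $(x;y)$. $\Phi$ is SCD regular around $(x,y)$ if it has the SCD property around $(x,y)$ and every $L\in\mathcal S^*_\Phi(x,y)$ satisfies: $(y^*;0)\in L\Rightarrow y^*=0$. $\Phi$ is SCD semismooth* at $(\bar x,\bar y)\in\operatorname{gph}\Phi$ if it has the SCD property around $(\bar x,\bar y)$ and for every $\epsilon>0$ there is $\delta>0$ such that $|\langle x^*,x-\bar x\rangle-\langle y^*,y-\bar y\rangle|\le\epsilon\|(x;y)-(\bar x;\bar y)\|\|(x^*;y^* )\|$ for all $(x;y)\in\operatorname{gph}\Phi$ within distance $\delta$ of $(\bar x;\bar y)$ and all $(y^*;x^* )\in\bigcup\mathcal S^*_\Phi(x,y)$ (the union of the subspaces in $\mathcal S^*_\Phi(x,y)$). Proximal notions. For $\gamma>0$, $\mathcal P_{\gamma^{-1}q}(z):=\arg\min_w\{q(w)+\frac{\gamma}{2}\|w-z\|^2\}$ and $u_\gamma(x):=\mathcal P_{\gamma^{-1}q}(x-\gamma^{-1}F(x))-x$. The Bouligand subdifferential $\partial_B\Psi(z)$ of a locally Lipschitz map $\Psi$ is the set of limits of $\Psi'(z_k)$ over $z_k\to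 z$ with $\Psi$ differentiable at $z_k$. Define $\mathcal T_{u_\gamma}(x):=\{B(I-\gamma^{-1}F'(x))-I\mid B\in\partial_B\mathcal P_{\gamma^{-1}q}(x-\gamma^{-1}F(x))\}$. Algorithm B (a G-semismooth Newton method). For $k=0,1,\dots$: (1) if $0\in F(x^{(k)})+\partial q(x^{(k)})$, stop; (2) select $\gamma^{(k)}>0$ and compute $u^{(k)}:=u_{\gamma^{(k)}}(x^{(k)})$; (3) select $V^{(k)}\in\mathcal T_{u_{\gamma^{(k)}}}(x^{(k)})$, compute $\Delta x^{(k)}$ from $V^{(k)}\Delta x^{(k)}=-u^{(k)}$, and set $x^{(k+1)}:=x^{(k)}+\Delta x^{(k)}$. Superlinear convergence means $x^{(k)}\to\bar x$ with $\|x^{(k+1)}-\bar x\|=o(\|x^{(k)}-\bar x\|)$; finite termination at $\bar x$ is included as a degenerate case. *)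

theory Defs
  imports "HOL-Analysis.Analysis" "HOL-Library.Landau_Symbols"
begin

section \<open>The metric space of middle-dimensional subspaces\<close>

definition Zn :: "('a::euclidean_space \<times> 'a) set set" where
  "Zn = {L. subspace L \<and> dim L = DIM('a)}"

definition orth_proj :: "'b::euclidean_space set \<Rightarrow> 'b \<Rightarrow> 'b" where
  "orth_proj L z = (THE p. p \<in> L \<and> (\<forall>w\<in>L. orthogonal (z - p) w))"

definition Zn_dist :: "('a::euclidean_space \<times> 'a) set \<Rightarrow> ('a \<times> 'a) set \<Rightarrow> real" where
  "Zn_dist L1 L2 = onorm (\<lambda>z. orth_proj L1 z - orth_proj L2 z)"

definition adj_subspace :: "('a::euclidean_space \<times> 'a) set \<Rightarrow> ('a \<times> 'a) set" where
  "adj_subspace L = {(- v, u) | u v. (u, v) \<in> orthogonal_comp L}"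


section \<open>SCD derivatives of set-valued maps\<close>

definition gph :: "('a \<Rightarrow> 'b set) \<Rightarrow> ('a \<times> 'b) set" where
  "gph \<Phi> = {(x, y). y \<in> \<Phi> x}"

definition contingent_cone :: "'b::real_normed_vector set \<Rightarrow> 'b \<Rightarrow> 'b set" where
  "contingent_cone A z =
     {w. \<exists>t W. (\<forall>k::nat. t k > (0::real)) \<and> t \<longlonglongrightarrow> 0 \<and> W \<longlonglongrightarrow> w \<and> (\<forall>k. z + t k *\<^sub>R W k \<in> A)}"

definition scd_hat ::
  "('a::euclidean_space \<Rightarrow> 'a set) \<Rightarrow> 'a \<times> 'a \<Rightarrow> ('a \<times> 'a) set set" where
  "scd_hat \<Phi> z =
     (if z \<in> gph \<Phi> \<and> contingent_cone (gph \<Phi>) z \<in> Zn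
      then {adj_subspace (contingent_cone (gph \<Phi>) z)} else {})"

definition scd_deriv ::
  "('a::euclidean_space \<Rightarrow> 'a set) \<Rightarrow> 'a \<times> 'a \<Rightarrow> ('a \<times> 'a) set set" where
  "scd_deriv \<Phi> z =
     {L \<in> Zn. \<exists>Z Ls. (\<forall>k::nat. Z k \<in> gph \<Phi> \<and> Ls k \<in> scd_hat \<Phi> (Z k)) \<and>
                 Z \<longlonglongrightarrow> z \<and> (\<lambda>k. Zn_dist (Ls k) L) \<longlonglongrightarrow> 0}"

definition scd_property :: "('a::euclidean_space \<Rightarrow> 'a set) \<Rightarrow> 'a \<times> 'a \<Rightarrow> bool" where
  "scd_property \<Phi> z \<longleftrightarrow>
     z \<in> gph \<Phi> \<and> (\<forall>\<^sub>F z' in nhds z. z' \<in> gph \<Phi> \<longrightarrow> scd_deriv \<Phi> z' \<noteq> {})"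

definition scd_regular :: "('a::euclidean_space \<Rightarrow> 'a set) \<Rightarrow> 'a \<times> 'a \<Rightarrow> bool" where
  "scd_regular \<Phi> z \<longleftrightarrow>
     scd_property \<Phi> z \<and> (\<forall>L\<in>scd_deriv \<Phi> z. \<forall>ys. (ys, 0) \<in> L \<longrightarrow> ys = 0)"

definition scd_semismooth :: "('a::euclidean_space \<Rightarrow> 'a set) \<Rightarrow> 'a \<times> 'a \<Rightarrow> bool" where
  "scd_semismooth \<Phi> zb \<longleftrightarrow>
     scd_property \<Phi> zb \<and>
     (\<forall>\<epsilon>>0. \<exists>\<delta>>0. \<forall>x y xs ys.
        (x, y) \<in> gph \<Phi> \<longrightarrow> dist (x, y) zb \<le> \<delta> \<longrightarrow> (ys, xs) \<in> \<Union> (scd_deriv \<Phi> (x, y)) \<longrightarrow>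
        \<bar>xs \<bullet> (x - fst zb) - ys \<bullet> (y - snd zb)\<bar> \<le> \<epsilon> * norm ((x, y) - zb) * norm (xs, ys))"


section \<open>Convex functions, subdifferential and proximal map\<close>

definition ereal_epigraph :: "('a \<Rightarrow> ereal) \<Rightarrow> ('a \<times> real) set" where
  "ereal_epigraph q = {(x, r). q x \<le> ereal r}"

definition closed_proper_convex :: "('a::euclidean_space \<Rightarrow> ereal) \<Rightarrow> bool" where
  "closed_proper_convex q \<longleftrightarrow>
     (\<forall>x. q x \<noteq> -\<infinity>) \<and> (\<exists>x. q x \<noteq> \<infinity>) \<and>
     convex (ereal_epigraph q) \<and> closed (ereal_epigraph q)"

definition subdiff :: "('a::euclidean_space \<Rightarrow> ereal) \<Rightarrow> 'a \<Rightarrow> 'a set" where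
  "subdiff q x = {g. \<bar>q x\<bar> \<noteq> \<infinity> \<and> (\<forall>y. q x + ereal (g \<bullet> (y - x)) \<le> q y)}"

definition sum_map ::
  "('a::euclidean_space \<Rightarrow> 'a) \<Rightarrow> ('a \<Rightarrow> ereal) \<Rightarrow> 'a \<Rightarrow> 'a set" where
  "sum_map F q x = {F x + g | g. g \<in> subdiff q x}"

text \<open>For closed proper convex \<open>q\<close> and \<open>\<gamma> > 0\<close> the minimizer exists and is unique, so the
  choice made by \<^const>\<open>arg_min\<close> is immaterial.\<close>

definition prox :: "('a::euclidean_space \<Rightarrow> ereal) \<Rightarrow> real \<Rightarrow> 'a \<Rightarrow> 'a" where
  "prox q \<gamma> z = (ARG_MIN (\<lambda>w. q w + ereal (\<gamma> / 2 * (norm (w - z))\<^sup>2)) w. True)"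

definition prox_residual ::
  "('a::euclidean_space \<Rightarrow> 'a) \<Rightarrow> ('a \<Rightarrow> ereal) \<Rightarrow> real \<Rightarrow> 'a \<Rightarrow> 'a" where
  "prox_residual F q \<gamma> x = prox q \<gamma> (x - (1 / \<gamma>) *\<^sub>R F x) - x"

definition bouligand_subdiff ::
  "('a::euclidean_space \<Rightarrow> 'b::euclidean_space) \<Rightarrow> 'a \<Rightarrow> ('a \<Rightarrow>\<^sub>L 'b) set" where
  "bouligand_subdiff \<Psi> z =
     {B. \<exists>Z D. Z \<longlonglongrightarrow> z \<and> D \<longlonglongrightarrow> B \<and>
           (\<forall>k::nat. (\<Psi> has_derivative blinfun_apply (D k)) (at (Z k)))}"


section \<open>The Newton method\<close>

text \<open>\<open>F'\<close> stands for the derivative of \<open>F\<close>.\<close>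

definition newton_maps ::
  "('a::euclidean_space \<Rightarrow> 'a) \<Rightarrow> ('a \<Rightarrow> 'a \<Rightarrow>\<^sub>L 'a) \<Rightarrow> ('a \<Rightarrow> ereal) \<Rightarrow> real \<Rightarrow> 'a \<Rightarrow> ('a \<Rightarrow>\<^sub>L 'a) set"
  where
  "newton_maps F F' q \<gamma> x =
     {(B o\<^sub>L (id_blinfun - (1 / \<gamma>) *\<^sub>R F' x)) - id_blinfun | B.
        B \<in> bouligand_subdiff (prox q \<gamma>) (x - (1 / \<gamma>) *\<^sub>R F x)}"

text \<open>The first \<open>N\<close> iterations have been carried out without stopping, starting from \<open>x 0\<close> and
  producing \<open>x 1, \<dots>, x N\<close>; values of the sequences at later indices are irrelevant.
  \<open>N = \<infinity>\<close> describes a run that never stops.\<close>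

definition newton_iterates ::
  "('a::euclidean_space \<Rightarrow> 'a) \<Rightarrow> ('a \<Rightarrow> 'a \<Rightarrow>\<^sub>L 'a) \<Rightarrow> ('a \<Rightarrow> ereal) \<Rightarrow>
   enat \<Rightarrow> (nat \<Rightarrow> real) \<Rightarrow> (nat \<Rightarrow> 'a \<Rightarrow>\<^sub>L 'a) \<Rightarrow> (nat \<Rightarrow> 'a) \<Rightarrow> bool" where
  "newton_iterates F F' q N \<gamma> V x \<longleftrightarrow>
     (\<forall>k. enat k < N \<longrightarrow>
        0 \<notin> sum_map F q (x k) \<and> \<gamma> k > 0 \<and> V k \<in> newton_maps F F' q (\<gamma> k) (x k) \<and>
        (\<exists>d. blinfun_apply (V k) d = - prox_residual F q (\<gamma> k) (x k) \<and> x (Suc k) = x k + d))"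

definition converges_superlinearly :: "(nat \<Rightarrow> 'a::real_normed_vector) \<Rightarrow> 'a \<Rightarrow> bool" where
  "converges_superlinearly x xb \<longleftrightarrow>
     x \<longlonglongrightarrow> xb \<and> (\<lambda>k. norm (x (Suc k) - xb)) \<in> o(\<lambda>k. norm (x k - xb))"

end

theory Submission
  imports Defs
begin

text \<open>
  The proximal map \<open>P\<close> of \<open>q\<close> with parameter \<open>\<gamma>\<close> is nonexpansive, and
  \<open>z \<mapsto> (P z, \<gamma> (z - P z) + F (P z))\<close> (Minty's parametrization) is a homeomorphism onto the graph of
  \<open>F + \<partial>q\<close>. Through it the graph has a middle-dimensional tangent space exactly where \<open>P\<close> is
  differentiable, so limits of tangent spaces correspond to elements \<open>B\<close> of the Bouligand
  subdifferential of \<open>P\<close>. In particular the SCD property provides points of differentiability without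
  Rademacher's theorem. Testing the semismooth* inequality for \<open>\<partial>q\<close> with
  \<open>x\<^sup>* = (I - B\<^sup>T) r\<close>, \<open>y\<^sup>* = \<gamma>\<^sup>-\<^sup>1 B\<^sup>T r\<close> and \<open>r = P z - P z' - B (z - z')\<close> yields semismoothness of \<open>P\<close>,
  while SCD regularity of \<open>F + \<partial>q\<close> makes every limit \<open>V\<close> of Newton maps at the solution injective.
  By compactness of \<open>[\<gamma>lo, \<gamma>hi]\<close> and of the unit ball both properties are uniform, and the usual
  Newton estimate \<open>V (x\<^sup>+ - xb) = V (x - xb) - u(x) = o(\<parallel>x - xb\<parallel>)\<close> gives superlinear convergence.
\<close>

section \<open>The proximal map\<close>

lemma subdiff_realE:
  assumes "g \<in> subdiff q x"
  obtains a where "q x = ereal a"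
    and "\<And>y b. q y \<le> ereal b \<Longrightarrow> a + g \<bullet> (y - x) \<le> b"
proof -
  obtain a where a: "q x = ereal a" using assms by (auto simp: subdiff_def)
  \<comment> \<open>Letting \<open>b\<close> range over the real heights above \<open>q y\<close>,
    that is over epigraph points, keeps all later uses in real arithmetic.\<close>
  have "a + g \<bullet> (y - x) \<le> b" if "q y \<le> ereal b" for y b
  proof -
    have "ereal a + ereal (g \<bullet> (y - x)) \<le> q y" using assms a by (auto simp: subdiff_def)
    then show ?thesis using that order_trans by fastforce
  qed
  with a show thesis by (rule that)
qed

lemma subdiff_monotone:
  assumes "g \<in> subdiff q x" and "g' \<in> subdiff q x'"
  shows "(g - g') \<bullet> (x - x') \<ge> 0"
proof -
  obtain a where a: "q x = ereal a" "\<And>y b. q y \<le> ereal b \<Longrightarrow> a + g \<bullet> (y - x) \<le> b"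
    using subdiff_realE[OF assms(1)] by blast
  obtain a' where a': "q x' = ereal a'" "\<And>y b. q y \<le> ereal b \<Longrightarrow> a' + g' \<bullet> (y - x') \<le> b"
    using subdiff_realE[OF assms(2)] by blast
  have "a + g \<bullet> (x' - x) \<le> a'" "a' + g' \<bullet> (x - x') \<le> a" using a a' by auto
  then show ?thesis by (simp add: inner_diff_left inner_diff_right)
qed

text \<open>Weierstrass on the epigraph: its closedness plays the part of lower semicontinuity of
  \<open>q\<close>, and the quadratic term dominates the affine minorant given by \<open>g\<close>,
  so a sublevel set of the continuous function \<open>h\<close> on the epigraph is compact.\<close>

lemma prox_minimizer_exists:
  fixes q :: "'a::euclidean_space \<Rightarrow> ereal"
  assumes q: "closed_proper_convex q" and x0: "g \<in> subdiff q x0" and "\<gamma> > 0"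
  shows "\<exists>w. is_arg_min (\<lambda>w. q w + ereal (\<gamma> / 2 * (norm (w - z))\<^sup>2)) (\<lambda>_. True) w"
proof -
  obtain a where a: "q x0 = ereal a" "\<And>y b. q y \<le> ereal b \<Longrightarrow> a + g \<bullet> (y - x0) \<le> b"
    using subdiff_realE[OF x0] by blast
  define h where "h = (\<lambda>(w, r::real). r + \<gamma> / 2 * (norm (w - z))\<^sup>2)"
  have h_cont: "continuous_on S h" for S
    unfolding h_def case_prod_unfold by (intro continuous_intros)
  define S where "S = ereal_epigraph q \<inter> {p. h p \<le> h (x0, a)}"
  have "closed S"
    unfolding S_def using q h_cont
    by (intro closed_Int closed_Collect_le) (auto simp: closed_proper_convex_def)
  \<comment> \<open>With t = \<open>norm (w - z)\<close>, the minorant and the level bound give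
    \<gamma>/2 t^2 \<le> C + |g| t. For t > 1 this forces t \<le> 2 (C + |g|)/\<gamma>; the summand
    1 in \<open>R\<close> covers t \<le> 1.\<close>
  define C where "C = \<bar>h (x0, a) - a - g \<bullet> (z - x0)\<bar>"
  define R where "R = 1 + 2 * (C + norm g) / \<gamma>"
  have bnd: "norm (w - z) \<le> R" "r \<le> h (x0, a)" "a - norm g * (R + norm (z - x0)) \<le> r" if "(w, r) \<in> S" for w r
  proof -
    have 1: "a + g \<bullet> (w - x0) \<le> r" and 2: "r + \<gamma> / 2 * (norm (w - z))\<^sup>2 \<le> h (x0, a)"
      using that a(2) by (auto simp: S_def h_def ereal_epigraph_def)
    have gw: "g \<bullet> (w - x0) = g \<bullet> (w - z) + g \<bullet> (z - x0)" by (simp add: inner_diff_right)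
    have n1: "- (g \<bullet> (w - z)) \<le> norm g * norm (w - z)"
      using Cauchy_Schwarz_ineq2[of g "w - z"] by linarith
    have key: "\<gamma> / 2 * (norm (w - z))\<^sup>2 \<le> C + norm g * norm (w - z)"
      using 1 2 gw n1 unfolding C_def by linarith
    show nR: "norm (w - z) \<le> R"
    proof (cases "norm (w - z) \<le> 1")
      case True then show ?thesis unfolding R_def C_def using \<open>\<gamma> > 0\<close>
        by (smt (verit) divide_nonneg_pos norm_ge_zero)
    next
      case False
      have "C + norm g * norm (w - z) \<le> (C + norm g) * norm (w - z)"
      proof -
        have "C * 1 \<le> C * norm (w - z)" using False by (intro mult_left_mono) (auto simp: C_def)
        then show ?thesis by (simp add: algebra_simps)
      qed
      then have "(\<gamma> / 2 * norm (w - z)) * norm (w - z) \<le> (C + norm g) * norm (w - z)"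
        using key by (simp add: power2_eq_square mult.assoc)
      then have "\<gamma> / 2 * norm (w - z) \<le> C + norm g"
        using False by (elim mult_right_le_imp_le) auto
      then have "norm (w - z) \<le> 2 * (C + norm g) / \<gamma>" using \<open>\<gamma> > 0\<close> by (simp add: field_simps)
      then show ?thesis unfolding R_def by simp
    qed
    have "0 \<le> \<gamma> / 2 * (norm (w - z))\<^sup>2" using \<open>\<gamma> > 0\<close> by simp
    then show "r \<le> h (x0, a)" using 2 by linarith
    have "norm (w - x0) \<le> R + norm (z - x0)"
      using norm_triangle_ineq[of "w - z" "z - x0"] nR by simp
    then have "norm g * norm (w - x0) \<le> norm g * (R + norm (z - x0))" by (intro mult_left_mono) auto
    moreover have "\<bar>g \<bullet> (w - x0)\<bar> \<le> norm g * norm (w - x0)" by (rule Cauchy_Schwarz_ineq2)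
    ultimately show "a - norm g * (R + norm (z - x0)) \<le> r" using 1 by linarith
  qed
  have "bounded S"
  proof (rule bounded_subset)
    show "bounded (cball z R \<times> {a - norm g * (R + norm (z - x0))..h (x0, a)})"
      by (intro bounded_Times) auto
    show "S \<subseteq> cball z R \<times> {a - norm g * (R + norm (z - x0))..h (x0, a)}"
      using bnd by (auto simp: dist_norm norm_minus_commute)
  qed
  with \<open>closed S\<close> have "compact S" by (simp add: compact_eq_bounded_closed)
  moreover have "(x0, a) \<in> S" using a by (auto simp: S_def ereal_epigraph_def)
  ultimately obtain p where p: "p \<in> S" "\<And>p'. p' \<in> S \<Longrightarrow> h p \<le> h p'"
    using continuous_attains_inf[of S h] h_cont by blast
  obtain w r where wr: "p = (w, r)" by (cases p)
  have qw: "q w \<le> ereal r" using p wr by (auto simp: S_def ereal_epigraph_def)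
  have "q w + ereal (\<gamma> / 2 * (norm (w - z))\<^sup>2) \<le> q y + ereal (\<gamma> / 2 * (norm (y - z))\<^sup>2)" for y
  proof (cases "q y")
    case (real b)
    \<comment> \<open>\<open>p\<close> minimizes \<open>h\<close> over \<open>S\<close> only; an
      epigraph point outside \<open>S\<close> lies above the level of \<open>(x0, a)\<close>, which
      is itself in \<open>S\<close>.\<close>
    have "h p \<le> h (y, b)"
    proof (cases "(y, b) \<in> S")
      case False
      then have "h (x0, a) < h (y, b)" using real by (auto simp: S_def ereal_epigraph_def)
      then show ?thesis using p(2)[OF \<open>(x0, a) \<in> S\<close>] by simp
    qed (rule p)
    then have "ereal r + ereal (\<gamma> / 2 * (norm (w - z))\<^sup>2) \<le> q y + ereal (\<gamma> / 2 * (norm (y - z))\<^sup>2)"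
      using real by (simp add: h_def wr)
    then show ?thesis by (rule order_trans[OF add_right_mono[OF qw]])
  next
    case MInf then show ?thesis using q by (auto simp: closed_proper_convex_def)
  qed simp
  then show ?thesis by (auto simp: is_arg_min_def not_less)
qed

text \<open>Fermat's rule by hand: compare \<open>w\<close> with the point at parameter
  \<open>t\<close> on the segment to \<open>y\<close>, bound \<open>q\<close> there by convexity,
  divide by \<open>t\<close> and let \<open>t\<close> decrease to 0, which removes the quadratic
  remainder.\<close>

lemma prox_minimizer_subdiff:
  fixes q :: "'a::euclidean_space \<Rightarrow> ereal"
  assumes q: "closed_proper_convex q" and "\<gamma> > 0"
    and min: "is_arg_min (\<lambda>w. q w + ereal (\<gamma> / 2 * (norm (w - z))\<^sup>2)) (\<lambda>_. True) w"
  shows "\<gamma> *\<^sub>R (z - w) \<in> subdiff q w"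
proof -
  have le: "q w + ereal (\<gamma> / 2 * (norm (w - z))\<^sup>2) \<le> q y + ereal (\<gamma> / 2 * (norm (y - z))\<^sup>2)" for y
    using min by (auto simp: is_arg_min_def not_less)
  have fin: "\<bar>q w\<bar> \<noteq> \<infinity>"
  proof -
    obtain y where "q y \<noteq> \<infinity>" using q by (auto simp: closed_proper_convex_def)
    with le[of y] have "q w \<noteq> \<infinity>" by (cases "q y") auto
    then show ?thesis using q by (cases "q w") (auto simp: closed_proper_convex_def)
  qed
  then obtain a where a: "q w = ereal a" by auto
  have "q w + ereal ((\<gamma> *\<^sub>R (z - w)) \<bullet> (y - w)) \<le> q y" for y
  proof (cases "q y")
    case (real b)
    have ineq: "0 \<le> (b - a) + \<gamma> * ((w - z) \<bullet> (y - w)) + t * (\<gamma> / 2 * (norm (y - w))\<^sup>2)"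
      if t: "0 < t" "t \<le> 1" for t
    proof -
      define v where "v = w + t *\<^sub>R (y - w)"
      have "(1 - t) *\<^sub>R (w, a) + t *\<^sub>R (y, b) \<in> ereal_epigraph q"
        using q t a real
        by (intro convexD_alt) (auto simp: closed_proper_convex_def ereal_epigraph_def)
      then have "q v \<le> ereal (a + t * (b - a))"
        by (simp add: ereal_epigraph_def v_def algebra_simps)
      from order_trans[OF le[of v] add_right_mono[OF this]]
      have "ereal a + ereal (\<gamma> / 2 * (norm (w - z))\<^sup>2)
          \<le> ereal (a + t * (b - a)) + ereal (\<gamma> / 2 * (norm (v - z))\<^sup>2)"
        by (simp only: a)
      moreover have nv: "(norm (v - z))\<^sup>2
          = (norm (w - z))\<^sup>2 + 2 * t * ((w - z) \<bullet> (y - w)) + t\<^sup>2 * (norm (y - w))\<^sup>2"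
        unfolding v_def power2_norm_eq_inner
        by (simp add: algebra_simps power2_eq_square inner_commute)
      ultimately have "0 \<le> t * ((b - a) + \<gamma> * ((w - z) \<bullet> (y - w)) + t * (\<gamma> / 2 * (norm (y - w))\<^sup>2))"
        unfolding nv by (simp add: distrib_left right_diff_distrib power2_eq_square mult_ac)
      then show ?thesis using t by (simp add: zero_le_mult_iff)
    qed
    have lim: "((\<lambda>t. (b - a) + \<gamma> * ((w - z) \<bullet> (y - w)) + t * (\<gamma> / 2 * (norm (y - w))\<^sup>2))
          \<longlongrightarrow> (b - a) + \<gamma> * ((w - z) \<bullet> (y - w)) + 0 * (\<gamma> / 2 * (norm (y - w))\<^sup>2)) (at_right 0)"
      by (intro tendsto_intros)
    have "0 \<le> (b - a) + \<gamma> * ((w - z) \<bullet> (y - w)) + 0 * (\<gamma> / 2 * (norm (y - w))\<^sup>2)"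
      using lim
    proof (rule tendsto_lowerbound)
      show "\<forall>\<^sub>F t in at_right 0. 0 \<le> (b - a) + \<gamma> * ((w - z) \<bullet> (y - w)) + t * (\<gamma> / 2 * (norm (y - w))\<^sup>2)"
        using ineq unfolding eventually_at_right_field by (intro exI[of _ 1]) auto
    qed simp
    then show ?thesis using real a by (simp add: inner_diff_left algebra_simps)
  next
    case MInf then show ?thesis using q by (auto simp: closed_proper_convex_def)
  qed simp
  then show ?thesis using fin by (simp add: subdiff_def)
qed

text \<open>A subgradient somewhere supplies the affine minorant behind the existence of minimizers.
  In the application it is \<open>- F xb\<close>, a subgradient at the solution.\<close>

locale prox_setting =
  fixes q :: "'a::euclidean_space \<Rightarrow> ereal"
  assumes cpc: "closed_proper_convex q"
    and subdiff_nonempty: "\<exists>x. subdiff q x \<noteq> {}"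
begin

lemma prox_subdiff:
  assumes "\<gamma> > 0"
  shows "\<gamma> *\<^sub>R (z - prox q \<gamma> z) \<in> subdiff q (prox q \<gamma> z)"
proof -
  obtain x g where "g \<in> subdiff q x" using subdiff_nonempty by blast
  from prox_minimizer_exists[OF cpc this assms] show ?thesis
    unfolding prox_def arg_min_def
    by (intro prox_minimizer_subdiff[OF cpc assms]) (rule someI_ex)
qed

text \<open>Monotonicity of the subdifferential makes identity plus \<gamma>^-1 times the
  subdifferential strongly monotone with modulus 1. As \<open>prox\<close> inverts this map,
  uniqueness and nonexpansiveness both follow from the one inequality.\<close>

lemma prox_strongly_monotone:
  assumes "\<gamma> > 0" and "g \<in> subdiff q w" "g' \<in> subdiff q w'"
  shows "(norm (w - w'))\<^sup>2 \<le> ((w + (1/\<gamma>) *\<^sub>R g) - (w' + (1/\<gamma>) *\<^sub>R g')) \<bullet> (w - w')"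
proof -
  have "0 \<le> (1/\<gamma>) * ((g - g') \<bullet> (w - w'))" using subdiff_monotone[OF assms(2,3)] assms(1) by simp
  then show ?thesis by (simp add: power2_norm_eq_inner algebra_simps)
qed

lemma prox_eqI:
  assumes "\<gamma> > 0" and "g \<in> subdiff q w"
  shows "prox q \<gamma> (w + (1/\<gamma>) *\<^sub>R g) = w"
proof -
  define z where "z = w + (1/\<gamma>) *\<^sub>R g"
  have "(norm (w - prox q \<gamma> z))\<^sup>2 \<le> 0"
    using prox_strongly_monotone[OF assms prox_subdiff[OF assms(1), of z]] assms(1)
    by (simp add: z_def)
  then show ?thesis by (simp add: z_def)
qed

lemma prox_nonexpansive:
  assumes "\<gamma> > 0"
  shows "norm (prox q \<gamma> z - prox q \<gamma> z') \<le> norm (z - z')"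
proof -
  have "(norm (prox q \<gamma> z - prox q \<gamma> z'))\<^sup>2 \<le> (z - z') \<bullet> (prox q \<gamma> z - prox q \<gamma> z')"
    using prox_strongly_monotone[OF assms prox_subdiff[OF assms, of z] prox_subdiff[OF assms, of z']] assms
    by simp
  also have "\<dots> \<le> norm (z - z') * norm (prox q \<gamma> z - prox q \<gamma> z')" by (rule norm_cauchy_schwarz)
  finally show ?thesis
    by (metis mult_le_cancel_right norm_ge_zero order.order_iff_strict power2_eq_square)
qed

end

section \<open>Convergence of subspaces\<close>

lemma orth_projI:
  assumes "subspace L" and "p \<in> L" and orth: "\<And>w. w \<in> L \<Longrightarrow> orthogonal (z - p) w"
  shows "orth_proj L z = p"
  unfolding orth_proj_def
proof (rule the_equality)
  show "p \<in> L \<and> (\<forall>w\<in>L. orthogonal (z - p) w)" using assms by blast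
  fix p' assume p': "p' \<in> L \<and> (\<forall>w\<in>L. orthogonal (z - p') w)"
  have "p' - p \<in> L" using assms p' by (intro subspace_diff) auto
  then have "orthogonal (z - p) (p' - p)" "orthogonal (z - p') (p' - p)" using orth p' by auto
  then have "(p' - p) \<bullet> (p' - p) = 0" by (simp add: orthogonal_def inner_diff_left)
  then show "p' = p" by simp
qed

lemma
  assumes "subspace L"
  shows orth_proj_in: "orth_proj L z \<in> L"
    and orth_proj_orthogonal: "w \<in> L \<Longrightarrow> orthogonal (z - orth_proj L z) w"
proof -
  obtain p y where "p \<in> span L" "\<And>w. w \<in> span L \<Longrightarrow> orthogonal y w" "z = p + y"
    using orthogonal_subspace_decomp_exists[of L z] by blast
  moreover have "span L = L" using assms by (simp add: span_eq_iff)
  ultimately have *: "p \<in> L" "\<And>w. w \<in> L \<Longrightarrow> orthogonal (z - p) w" by auto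
  then have "orth_proj L z = p" using assms by (intro orth_projI)
  with * show "orth_proj L z \<in> L" "w \<in> L \<Longrightarrow> orthogonal (z - orth_proj L z) w" by auto
qed

lemma orth_proj_norm_decomp:
  assumes "subspace L"
  shows "(norm z)\<^sup>2 = (norm (orth_proj L z))\<^sup>2 + (norm (z - orth_proj L z))\<^sup>2"
proof -
  have "orthogonal (orth_proj L z) (z - orth_proj L z)"
    using orth_proj_orthogonal[OF assms orth_proj_in[OF assms]] by (simp add: orthogonal_commute)
  from norm_add_Pythagorean[OF this] show ?thesis by simp
qed

lemma norm_orth_proj_le:
  assumes "subspace L"
  shows "norm (orth_proj L z) \<le> norm z" "norm (z - orth_proj L z) \<le> norm z"
proof -
  have "(norm (orth_proj L z))\<^sup>2 \<le> (norm z)\<^sup>2" "(norm (z - orth_proj L z))\<^sup>2 \<le> (norm z)\<^sup>2"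
    unfolding orth_proj_norm_decomp[OF assms, of z] by auto
  then show "norm (orth_proj L z) \<le> norm z" "norm (z - orth_proj L z) \<le> norm z" by simp_all
qed

lemma orth_proj_closest:
  assumes "subspace L" and "v \<in> L"
  shows "norm (z - orth_proj L z) \<le> norm (z - v)"
proof -
  have "orth_proj L z - v \<in> L" using assms by (intro subspace_diff orth_proj_in)
  then have "(norm (z - v))\<^sup>2 = (norm (z - orth_proj L z))\<^sup>2 + (norm (orth_proj L z - v))\<^sup>2"
    using norm_add_Pythagorean[of "z - orth_proj L z" "orth_proj L z - v"]
      orth_proj_orthogonal[OF assms(1), of "orth_proj L z - v" z] by simp
  then have "(norm (z - orth_proj L z))\<^sup>2 \<le> (norm (z - v))\<^sup>2" by simp
  then show ?thesis by simp
qed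

lemma linear_orth_proj:
  assumes "subspace L"
  shows "linear (orth_proj L)"
proof (rule linearI)
  note in_orth = orth_proj_in[OF assms] orth_proj_orthogonal[OF assms]
  show "orth_proj L (x + y) = orth_proj L x + orth_proj L y" for x y
  proof (rule orth_projI[OF assms])
    show "orthogonal (x + y - (orth_proj L x + orth_proj L y)) w" if "w \<in> L" for w
      using in_orth(2)[OF that, of x] in_orth(2)[OF that, of y]
      by (simp add: orthogonal_def inner_diff_left inner_add_left)
  qed (intro subspace_add[OF assms] in_orth)
  show "orth_proj L (c *\<^sub>R x) = c *\<^sub>R orth_proj L x" for c x
  proof (rule orth_projI[OF assms])
    show "orthogonal (c *\<^sub>R x - c *\<^sub>R orth_proj L x) w" if "w \<in> L" for w
      using in_orth(2)[OF that, of x]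
      by (simp add: orthogonal_def inner_diff_left inner_add_left)
  qed (intro subspace_scale[OF assms] in_orth)
qed

text \<open>With P1, P2 the two projections, P1 - P2 = (I - P2) P1 - P2 (I - P1). The first term is
  small because \<open>L1\<close> is close to \<open>L2\<close>, the second, by duality, because
  \<open>L2\<close> is close to \<open>L1\<close>; hence the factor 2.\<close>

lemma orth_proj_gap:
  assumes L1: "subspace L1" and L2: "subspace L2"
    and near12: "\<And>u. u \<in> L1 \<Longrightarrow> \<exists>v\<in>L2. norm (u - v) \<le> \<epsilon> * norm u"
    and near21: "\<And>u. u \<in> L2 \<Longrightarrow> \<exists>v\<in>L1. norm (u - v) \<le> \<epsilon> * norm u"
    and "\<epsilon> \<ge> 0"
  shows "norm (orth_proj L1 z - orth_proj L2 z) \<le> 2 * \<epsilon> * norm z"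
proof -
  define a where "a = orth_proj L1 z"
  define b where "b = orth_proj L2 (z - a)"
  have aL: "a \<in> L1" and bL: "b \<in> L2" using assms by (auto simp: a_def b_def orth_proj_in)
  have split: "orth_proj L1 z - orth_proj L2 z = (a - orth_proj L2 a) - b"
    using linear_diff[OF linear_orth_proj[OF L2]] by (simp add: a_def b_def)
  obtain v where v: "v \<in> L2" "norm (a - v) \<le> \<epsilon> * norm a" using near12[OF aL] by blast
  have "norm (a - orth_proj L2 a) \<le> \<epsilon> * norm a" using orth_proj_closest[OF L2 v(1)] v(2) order_trans by blast
  also have "\<dots> \<le> \<epsilon> * norm z" using norm_orth_proj_le(1)[OF L1, of z] \<open>\<epsilon> \<ge> 0\<close>
    by (auto simp: a_def intro: mult_left_mono)
  finally have 1: "norm (a - orth_proj L2 a) \<le> \<epsilon> * norm z" .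
  \<comment> \<open>\<open>b\<close> is the image under \<open>\<Pi>\<^sub>2\<close> of a vector orthogonal to \<open>L1\<close>, while \<open>b\<close> itself is almost in \<open>L1\<close>.\<close>
  obtain w where w: "w \<in> L1" "norm (b - w) \<le> \<epsilon> * norm b" using near21[OF bL] by blast
  have "(norm b)\<^sup>2 = (z - a) \<bullet> b"
    using orth_proj_orthogonal[OF L2 bL, of "z - a"]
    by (simp add: power2_norm_eq_inner orthogonal_def b_def inner_diff_left)
  also have "\<dots> = (z - a) \<bullet> (b - w)"
    using orth_proj_orthogonal[OF L1 w(1), of z] by (simp add: orthogonal_def a_def inner_diff_right)
  also have "\<dots> \<le> norm (z - a) * norm (b - w)" by (rule norm_cauchy_schwarz)
  also have "\<dots> \<le> norm z * (\<epsilon> * norm b)"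
    using w(2) norm_orth_proj_le(2)[OF L1, of z] by (intro mult_mono) (auto simp: a_def)
  finally have "norm b * norm b \<le> (\<epsilon> * norm z) * norm b" by (simp add: power2_eq_square mult_ac)
  then have 2: "norm b \<le> \<epsilon> * norm z"
    by (metis mult_right_le_imp_le mult_nonneg_nonneg norm_ge_zero order_less_le \<open>\<epsilon> \<ge> 0\<close>)
  show ?thesis unfolding split using 1 2 norm_triangle_ineq4[of "a - orth_proj L2 a" b] by linarith
qed

section \<open>The adjoint subspace as a rotated orthogonal complement\<close>

lemma subspace_adj_subspace: "subspace (adj_subspace L)"
proof -
  have "linear (\<lambda>(u, v). (- v, u) :: 'a \<times> 'a)" by (auto intro!: linearI)
  moreover have "adj_subspace L = (\<lambda>(u, v). (- v, u)) ` (orthogonal_comp L)"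
    by (auto simp: adj_subspace_def)
  ultimately show ?thesis by (simp add: linear_subspace_image subspace_orthogonal_comp)
qed

lemma adj_subspace_iff: "(ys, xs) \<in> adj_subspace L \<longleftrightarrow> (\<forall>(u, v)\<in>L. xs \<bullet> u = ys \<bullet> v)"
proof -
  have "(ys, xs) \<in> adj_subspace L \<longleftrightarrow> (xs, - ys) \<in> orthogonal_comp L"
    unfolding adj_subspace_def by (auto intro!: exI[of _ "- ys"])
  also have "\<dots> \<longleftrightarrow> (\<forall>(u, v)\<in>L. xs \<bullet> u = ys \<bullet> v)"
    by (auto simp: orthogonal_comp_def orthogonal_def inner_commute)
  finally show ?thesis .
qed

text \<open>In a space of dimension 2n the complement of an n-dimensional subspace again has
  dimension n, and the rotation \<open>J\<close> is injective.\<close>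

lemma adj_subspace_in_Zn:
  fixes L :: "('a::euclidean_space \<times> 'a) set"
  assumes "L \<in> Zn"
  shows "adj_subspace L \<in> Zn"
proof -
  define J where "J = (\<lambda>(u, v). (- v, u) :: 'a \<times> 'a)"
  have J: "linear J" "inj J" unfolding J_def by (auto intro!: linearI injI)
  have "adj_subspace L = J ` (orthogonal_comp L)"
    by (auto simp: adj_subspace_def J_def)
  then have "dim (adj_subspace L) = dim (orthogonal_comp L)"
    using J by (metis dim_image_eq inj_on_subset subset_UNIV)
  moreover have "dim {y \<in> UNIV. \<forall>x \<in> L. orthogonal x y} + dim L = DIM('a \<times> 'a)"
    using dim_subspace_orthogonal_to_vectors[of L UNIV] assms by (simp add: Zn_def)
  ultimately have "dim (adj_subspace L) = DIM('a)" using assms by (simp add: Zn_def orthogonal_comp_def)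
  then show ?thesis by (simp add: Zn_def subspace_adj_subspace)
qed

text \<open>The rotation J(u, v) = (-v, u) is an isometry, so projecting onto the rotated complement
  of \<open>L\<close> is the conjugate by J of identity minus the projection onto
  \<open>L\<close>.\<close>

lemma orth_proj_adj_subspace:
  assumes "subspace L"
  shows "orth_proj (adj_subspace L) (- v, u)
    = (- snd ((u, v) - orth_proj L (u, v)), fst ((u, v) - orth_proj L (u, v)))"
proof (rule orth_projI[OF subspace_adj_subspace])
  obtain a b where ab: "orth_proj L (u, v) = (a, b)" by (cases "orth_proj L (u, v)")
  have "(a, b) \<in> L" using orth_proj_in[OF assms, of "(u, v)"] ab by simp
  have orth: "orthogonal (u - a, v - b) w" if "w \<in> L" for w
    using orth_proj_orthogonal[OF assms that, of "(u, v)"] ab by simp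
  show "(- snd ((u, v) - orth_proj L (u, v)), fst ((u, v) - orth_proj L (u, v))) \<in> adj_subspace L"
    using orth unfolding adj_subspace_iff by (fastforce simp: ab orthogonal_def inner_diff_left)
  show "orthogonal ((- v, u) - (- snd ((u, v) - orth_proj L (u, v)), fst ((u, v) - orth_proj L (u, v)))) w"
    if "w \<in> adj_subspace L" for w
  proof -
    obtain ys xs where w: "w = (ys, xs)" by (cases w)
    have "xs \<bullet> a = ys \<bullet> b" using that \<open>(a, b) \<in> L\<close> by (auto simp: w adj_subspace_iff)
    then show ?thesis by (simp add: w ab orthogonal_def inner_commute)
  qed
qed

text \<open>By the conjugation formula, passing to adjoints leaves the size of projection
  differences unchanged, so the gap estimate for \<open>L1\<close> and \<open>L2\<close> carries
  over.\<close>

lemma Zn_dist_adj_subspace_gap: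
  fixes L1 L2 :: "('a::euclidean_space \<times> 'a) set"
  assumes L: "subspace L1" "subspace L2"
    and "\<And>u. u \<in> L1 \<Longrightarrow> \<exists>v\<in>L2. norm (u - v) \<le> \<epsilon> * norm u"
    and "\<And>u. u \<in> L2 \<Longrightarrow> \<exists>v\<in>L1. norm (u - v) \<le> \<epsilon> * norm u"
    and "\<epsilon> \<ge> 0"
  shows "Zn_dist (adj_subspace L1) (adj_subspace L2) \<le> 2 * \<epsilon>"
  unfolding Zn_dist_def
proof (rule onorm_bound)
  fix z :: "'a \<times> 'a"
  define u v where "u = snd z" and "v = - fst z"
  then have z: "z = (- v, u)" by simp
  have "norm (orth_proj (adj_subspace L1) z - orth_proj (adj_subspace L2) z)
      = norm (orth_proj L1 (u, v) - orth_proj L2 (u, v))"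
  proof -
    obtain a b where ab: "orth_proj L1 (u, v) = (a, b)" by fastforce
    obtain c d where cd: "orth_proj L2 (u, v) = (c, d)" by fastforce
    show ?thesis
      unfolding z orth_proj_adj_subspace[OF L(1)] orth_proj_adj_subspace[OF L(2)] ab cd
      by (simp add: norm_Pair norm_minus_commute add.commute)
  qed
  also have "\<dots> \<le> 2 * \<epsilon> * norm (u, v)" by (rule orth_proj_gap[OF assms])
  also have "norm (u, v) = norm z" by (simp add: z norm_Pair add.commute)
  finally show "norm (orth_proj (adj_subspace L1) z - orth_proj (adj_subspace L2) z) \<le> 2 * \<epsilon> * norm z" .
qed (use assms in simp)

lemma Zn_dist_nonneg:
  fixes L1 L2 :: "('a::euclidean_space \<times> 'a) set"
  assumes "subspace L1" "subspace L2"
  shows "0 \<le> Zn_dist L1 L2"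
proof -
  have "bounded_linear (orth_proj L)" if "subspace L" for L :: "('a \<times> 'a) set"
    using linear_orth_proj[OF that] linear_conv_bounded_linear by blast
  from onorm_pos_le[OF bounded_linear_sub[OF this[OF assms(1)] this[OF assms(2)]]]
  show ?thesis unfolding Zn_dist_def .
qed

text \<open>An injective \<open>A\<close> is bounded below, and operators near \<open>A\<close>
  share half of its lower bound. Hence \<open>Ak k x\<close> and \<open>A x\<close> are close
  relative to the norm of either one, which is the two-sided gap condition for the ranges.\<close>

lemma Zn_dist_adj_range_tendsto:
  fixes A :: "'a::euclidean_space \<Rightarrow>\<^sub>L ('a \<times> 'a)"
  assumes "Ak \<longlonglongrightarrow> A" and "inj (blinfun_apply A)"
  shows "(\<lambda>k. Zn_dist (adj_subspace (range (blinfun_apply (Ak k)))) (adj_subspace (range (blinfun_apply A)))) \<longlonglongrightarrow> 0"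
proof -
  have sub: "subspace (range (blinfun_apply B))" for B :: "'a \<Rightarrow>\<^sub>L ('a \<times> 'a)"
    by (simp add: linear_subspace_image bounded_linear.linear blinfun.bounded_linear_right)
  obtain c where c: "c > 0" "\<And>x. c * norm x \<le> norm (A x)"
    using linear_inj_bounded_below_pos[of "blinfun_apply A"] assms(2)
    by (metis bounded_linear.linear blinfun.bounded_linear_right)
  \<comment> \<open>The factor 2/c inverts the lower bound c/2 that holds for \<open>A\<close> and
    for every \<open>Ak k\<close> within distance c/2 of it.\<close>
  define e where "e = (\<lambda>k. 2 / c * norm (Ak k - A))"
  have null: "(\<lambda>k. norm (Ak k - A)) \<longlonglongrightarrow> 0" using assms(1) by (simp add: LIM_zero tendsto_norm_zero)
  have "(\<lambda>k. 2 * e k) \<longlonglongrightarrow> 2 * (2 / c * 0)" unfolding e_def by (intro tendsto_intros null)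
  then have lim: "(\<lambda>k. 2 * e k) \<longlonglongrightarrow> 0" by simp
  have "eventually (\<lambda>k. norm (Ak k - A) < c / 2) sequentially"
    using null c(1) by (intro order_tendstoD) auto
  then have ev: "eventually (\<lambda>k. Zn_dist (adj_subspace (range (blinfun_apply (Ak k))))
      (adj_subspace (range (blinfun_apply A))) \<le> 2 * e k) sequentially"
  proof eventually_elim
    case (elim k)
    have diff: "norm (Ak k x - A x) \<le> norm (Ak k - A) * norm x" for x
      using norm_blinfun[of "Ak k - A" x] by (simp add: blinfun.diff_left)
    have lowA: "norm x \<le> 2 / c * norm (A x)" for x
    proof -
      have "c * norm x \<le> 2 * norm (A x)" using c(2)[of x] norm_ge_zero[of "A x"] by linarith
      then show ?thesis using c(1) by (simp add: field_simps)
    qed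
    have lowAk: "norm x \<le> 2 / c * norm (Ak k x)" for x
    proof -
      have "norm (Ak k - A) * norm x \<le> c / 2 * norm x" using elim by (intro mult_right_mono) auto
      then have "norm (A x) \<le> norm (Ak k x) + c / 2 * norm x"
        using diff[of x] norm_triangle_ineq2[of "A x" "Ak k x"] by (simp add: norm_minus_commute)
      then have "c * norm x \<le> 2 * norm (Ak k x)" using c(2)[of x] by (simp add: algebra_simps)
      then show ?thesis using c(1) by (simp add: field_simps)
    qed
    have est: "norm (Ak k - A) * norm x \<le> e k * y" if "norm x \<le> 2 / c * y" for x :: 'a and y
      using mult_left_mono[OF that, of "norm (Ak k - A)"] by (simp add: e_def mult_ac)
    show ?case
    proof (rule Zn_dist_adj_subspace_gap[OF sub sub])
      show "\<exists>v\<in>range (blinfun_apply A). norm (u - v) \<le> e k * norm u"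
        if u: "u \<in> range (blinfun_apply (Ak k))" for u
      proof -
        obtain x where x: "u = Ak k x" using u by blast
        show ?thesis
          unfolding x using order_trans[OF diff[of x] est[OF lowAk[of x]]] by blast
      qed
      show "\<exists>v\<in>range (blinfun_apply (Ak k)). norm (u - v) \<le> e k * norm u"
        if u: "u \<in> range (blinfun_apply A)" for u
      proof -
        obtain x where x: "u = A x" using u by blast
        show ?thesis
          unfolding x using order_trans[OF diff[of x] est[OF lowA[of x]]]
          by (metis norm_minus_commute rangeI)
      qed
      show "0 \<le> e k" using c(1) by (simp add: e_def)
    qed
  qed
  show ?thesis
    by (rule tendsto_sandwich[OF _ ev tendsto_const lim])
      (auto intro!: always_eventually Zn_dist_nonneg subspace_adj_subspace)
qed

lemma range_in_Zn:
  fixes A :: "'a::euclidean_space \<Rightarrow>\<^sub>L ('a \<times> 'a)"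
  assumes "inj (blinfun_apply A)"
  shows "range (blinfun_apply A) \<in> Zn"
proof -
  have lin: "linear (blinfun_apply A)" by (simp add: bounded_linear.linear blinfun.bounded_linear_right)
  then have "dim (range (blinfun_apply A)) = DIM('a)"
    using dim_image_eq[OF lin] assms by simp
  with lin show ?thesis by (simp add: Zn_def linear_subspace_image)
qed

section \<open>Contingent cones and differentiability\<close>

text \<open>The Hadamard form of differentiability: the direction may move with \<open>k\<close>, as
  it does in the definition of the contingent cone.\<close>

lemma has_derivative_directional_seq:
  assumes f: "(f has_derivative f') (at z)"
    and t: "\<And>k. t k > (0::real)" "t \<longlonglongrightarrow> 0" and H: "H \<longlonglongrightarrow> h"
  shows "(\<lambda>k. (1 / t k) *\<^sub>R (f (z + t k *\<^sub>R H k) - f z)) \<longlonglongrightarrow> f' h"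
proof -
  interpret f': bounded_linear f' by (rule has_derivative_bounded_linear[OF f])
  have lim0: "(\<lambda>k. t k *\<^sub>R H k) \<longlonglongrightarrow> 0" using tendsto_scaleR[OF t(2) H] by simp
  \<comment> \<open>At \<open>d = 0\<close> the quotient has the value 0 by the convention on
    division, so \<open>R\<close> is continuous at 0 and may be composed with a sequence that hits
    0.\<close>
  define R where "R = (\<lambda>d. norm (f (z + d) - f z - f' d) / norm d)"
  have R: "R \<midarrow>0\<rightarrow> 0" using f by (simp add: has_derivative_at R_def)
  then have "isCont R 0" by (simp add: isCont_def R_def)
  from isCont_tendsto_compose[OF this lim0] have "(\<lambda>k. R (t k *\<^sub>R H k)) \<longlonglongrightarrow> 0" by (simp add: R_def)
  then have "(\<lambda>k. R (t k *\<^sub>R H k) * norm (H k)) \<longlonglongrightarrow> 0 * norm h"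
    by (intro tendsto_mult tendsto_norm H)
  moreover have "R (t k *\<^sub>R H k) * norm (H k)
      = norm ((1 / t k) *\<^sub>R (f (z + t k *\<^sub>R H k) - f z) - f' (H k))" for k
  proof (cases "H k = 0")
    case False
    define D where "D = f (z + t k *\<^sub>R H k) - f z - f' (t k *\<^sub>R H k)"
    have "(1 / t k) *\<^sub>R (f (z + t k *\<^sub>R H k) - f z) - f' (H k) = (1 / t k) *\<^sub>R D"
      using t(1)[of k] by (simp add: D_def f'.scaleR scaleR_diff_right)
    moreover have "R (t k *\<^sub>R H k) = norm D / norm (t k *\<^sub>R H k)" by (simp add: R_def D_def)
    ultimately show ?thesis using t(1)[of k] False by simp
  qed (simp add: f'.zero)
  ultimately have "(\<lambda>k. (1 / t k) *\<^sub>R (f (z + t k *\<^sub>R H k) - f z) - f' (H k)) \<longlonglongrightarrow> 0"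
    by (simp add: tendsto_norm_zero_iff)
  from tendsto_add[OF this f'.tendsto[OF H]] show ?thesis by simp
qed

text \<open>The differentiable left inverse turns convergent directions in the image into convergent
  directions in the parameter space, to which the derivative of \<open>\<phi>\<close>
  applies.\<close>

lemma contingent_cone_range:
  assumes \<phi>: "(\<phi> has_derivative \<phi>') (at z)"
    and \<psi>: "(\<psi> has_derivative \<psi>') (at (\<phi> z))" and inv: "\<And>x. \<psi> (\<phi> x) = x"
  shows "contingent_cone (range \<phi>) (\<phi> z) = range \<phi>'"
proof (intro equalityI subsetI)
  fix w assume "w \<in> contingent_cone (range \<phi>) (\<phi> z)"
  then obtain t W where t: "\<And>k. t k > (0::real)" "t \<longlonglongrightarrow> 0" and W: "W \<longlonglongrightarrow> w"
    and mem: "\<And>k. \<phi> z + t k *\<^sub>R W k \<in> range \<phi>" unfolding contingent_cone_def by blast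
  \<comment> \<open>Chosen so that \<open>z + t k *\<^sub>R H k\<close> is the parameter of the
    graph point \<open>\<phi> z + t k *\<^sub>R W k\<close>.\<close>
  define H where "H = (\<lambda>k. (1 / t k) *\<^sub>R (\<psi> (\<phi> z + t k *\<^sub>R W k) - \<psi> (\<phi> z)))"
  have H: "H \<longlonglongrightarrow> \<psi>' w" unfolding H_def by (rule has_derivative_directional_seq[OF \<psi> t W])
  have "\<phi> (z + t k *\<^sub>R H k) = \<phi> z + t k *\<^sub>R W k" for k
  proof -
    obtain x where x: "\<phi> z + t k *\<^sub>R W k = \<phi> x" using mem[of k] by blast
    have "z + t k *\<^sub>R H k = x" using t(1)[of k] by (simp add: H_def x inv)
    then show ?thesis using x by simp
  qed
  moreover have "(\<lambda>k. (1 / t k) *\<^sub>R (\<phi> (z + t k *\<^sub>R H k) - \<phi> z)) \<longlonglongrightarrow> \<phi>' (\<psi>' w)"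
    by (rule has_derivative_directional_seq[OF \<phi> t H])
  ultimately have "W \<longlonglongrightarrow> \<phi>' (\<psi>' w)" using t(1) by (simp add: less_imp_neq[symmetric])
  with W have "w = \<phi>' (\<psi>' w)" by (rule LIMSEQ_unique)
  then show "w \<in> range \<phi>'" by blast
next
  fix w assume "w \<in> range \<phi>'"
  then obtain h where h: "w = \<phi>' h" by blast
  define t where "t = (\<lambda>k. inverse (real (Suc k)))"
  have t: "\<And>k. t k > 0" "t \<longlonglongrightarrow> 0" unfolding t_def by (simp, rule LIMSEQ_inverse_real_of_nat)
  have "(\<lambda>k. (1 / t k) *\<^sub>R (\<phi> (z + t k *\<^sub>R h) - \<phi> z)) \<longlonglongrightarrow> w"
    unfolding h by (rule has_derivative_directional_seq[OF \<phi> t tendsto_const])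
  moreover have "\<phi> z + t k *\<^sub>R ((1 / t k) *\<^sub>R (\<phi> (z + t k *\<^sub>R h) - \<phi> z)) \<in> range \<phi>" for k
    using t(1)[of k] by simp
  ultimately show "w \<in> contingent_cone (range \<phi>) (\<phi> z)"
    using t unfolding contingent_cone_def by blast
qed

text \<open>The converse direction. A full-dimensional tangent subspace is carried bijectively onto
  the parameter space by the linear left inverse, and the inverse of this bijection is the only
  candidate for the derivative; compactness of the difference quotients shows that it is
  one.\<close>

lemma contingent_cone_range_Zn_imp_differentiable:
  fixes \<phi> :: "'a::euclidean_space \<Rightarrow> 'a \<times> 'a"
  assumes lip: "\<And>x y. norm (\<phi> x - \<phi> y) \<le> C * norm (x - y)"
    and \<psi>: "bounded_linear \<psi>" and inv: "\<And>x. \<psi> (\<phi> x) = x"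
    and cone: "contingent_cone (range \<phi>) (\<phi> z) \<in> Zn"
  shows "\<phi> differentiable (at z)"
proof -
  interpret \<psi>: bounded_linear \<psi> by (rule \<psi>)
  define T where "T = contingent_cone (range \<phi>) (\<phi> z)"
  have T: "subspace T" "dim T = DIM('a)" using cone by (auto simp: T_def Zn_def)
  \<comment> \<open>The Lipschitz estimate is an estimate for chords of the image; it survives the
    passage to tangent directions and makes \<open>\<psi>\<close> injective on
    \<open>T\<close>.\<close>
  have bnd: "norm w \<le> C * norm (\<psi> w)" if "w \<in> T" for w
  proof -
    from that have "\<exists>t W. (\<forall>k::nat. t k > (0::real)) \<and> W \<longlonglongrightarrow> w \<and> (\<forall>k. \<phi> z + t k *\<^sub>R W k \<in> range \<phi>)"
      unfolding T_def contingent_cone_def by blast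
    then obtain t W where t: "\<And>k::nat. t k > (0::real)" and W: "W \<longlonglongrightarrow> w"
      and mem: "\<And>k. \<phi> z + t k *\<^sub>R W k \<in> range \<phi>" by blast
    have "norm (W k) \<le> C * norm (\<psi> (W k))" for k
    proof -
      obtain x where x: "\<phi> z + t k *\<^sub>R W k = \<phi> x" using mem[of k] by blast
      have "\<psi> (\<phi> z + t k *\<^sub>R W k) = z + t k *\<^sub>R \<psi> (W k)" by (simp add: \<psi>.add \<psi>.scaleR inv)
      then have "x = z + t k *\<^sub>R \<psi> (W k)" using x inv by simp
      then have "norm (t k *\<^sub>R W k) \<le> C * norm (t k *\<^sub>R \<psi> (W k))"
        using lip[of x z] x[symmetric] by simp
      then show ?thesis using t[of k] by (simp add: mult.left_commute)
    qed
    then show ?thesis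
      by (intro LIMSEQ_le[OF tendsto_norm[OF W] tendsto_mult[OF tendsto_const tendsto_norm[OF \<psi>.tendsto[OF W]]]]) auto
  qed
  have inj: "inj_on \<psi> T"
  proof (rule inj_onI)
    fix u v assume "u \<in> T" "v \<in> T" "\<psi> u = \<psi> v"
    then have "norm (u - v) \<le> C * norm (\<psi> (u - v))" by (intro bnd subspace_diff T)
    then show "u = v" using \<open>\<psi> u = \<psi> v\<close> by (simp add: \<psi>.diff)
  qed
  \<comment> \<open>This is where membership in \<open>Zn\<close> enters: an injective linear map
    from \<open>T\<close> into a space of the same dimension is onto.\<close>
  have "\<psi> ` T = UNIV"
  proof -
    have "span T = T" using T(1) by (simp only: span_eq_iff)
    from dim_image_eq[OF \<psi>.linear, of T, unfolded this] have "dim (\<psi> ` T) = DIM('a)"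
      using inj T(2) by simp
    moreover have "subspace (\<psi> ` T)" by (rule linear_subspace_image[OF \<psi>.linear T(1)])
    ultimately show ?thesis using dim_eq_full span_eq_iff by blast
  qed
  define A where "A = inv_into T \<psi>"
  have A: "A h \<in> T" "\<psi> (A h) = h" for h
    using \<open>\<psi> ` T = UNIV\<close> by (auto simp: A_def inv_into_into f_inv_into_f)
  have A_eq: "A h = w" if "w \<in> T" "\<psi> w = h" for h w
    using inj_onD[OF inj, of "A h" w] A that by simp
  have "linear A"
    by (intro linearI A_eq) (simp_all add: A \<psi>.add \<psi>.scaleR subspace_add[OF T(1)] subspace_scale[OF T(1)])
  then have blA: "bounded_linear A" by (simp add: linear_conv_bounded_linear)
  interpret A: bounded_linear A by (rule blA)
  \<comment> \<open>If the remainder were at least \<open>e\<close> times the norm along some null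
    sequence, the difference quotients, bounded by \<open>C\<close>, would cluster at some
    \<open>w\<close> in \<open>T\<close>. The scaled remainder then tends to
    \<open>w - A (\<psi> w)\<close>, which is 0.\<close>
  have "(\<phi> has_derivative A) (at z)"
    unfolding has_derivative_at
  proof (intro conjI blA, rule ccontr)
    assume "\<not> (\<lambda>h. norm (\<phi> (z + h) - \<phi> z - A h) / norm h) \<midarrow>0\<rightarrow> 0"
    then obtain e where e: "e > 0"
      and bad: "\<And>s. s > 0 \<Longrightarrow> \<exists>h. h \<noteq> 0 \<and> norm h < s \<and> e \<le> norm (\<phi> (z + h) - \<phi> z - A h) / norm h"
      unfolding LIM_eq by fastforce
    have "\<exists>h. h \<noteq> 0 \<and> norm h < inverse (real (Suc k)) \<and> e \<le> norm (\<phi> (z + h) - \<phi> z - A h) / norm h" for k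
      by (rule bad) simp
    then obtain h where h: "\<And>k. h k \<noteq> 0" "\<And>k. norm (h k) < inverse (real (Suc k))"
      "\<And>k. e \<le> norm (\<phi> (z + h k) - \<phi> z - A (h k)) / norm (h k)" by metis
    define t where "t = (\<lambda>k. norm (h k))"
    have t: "\<And>k. t k > 0" using h(1) by (simp add: t_def)
    have t0: "t \<longlonglongrightarrow> 0" unfolding t_def
      by (rule tendsto_sandwich[OF _ _ tendsto_const LIMSEQ_inverse_real_of_nat])
        (use h(2) in \<open>auto intro!: always_eventually less_imp_le\<close>)
    define W where "W = (\<lambda>k. (1 / t k) *\<^sub>R (\<phi> (z + h k) - \<phi> z))"
    have "norm (W k) \<le> C" for k
      using lip[of "z + h k" z] t[of k] unfolding W_def norm_scaleR by (simp add: t_def field_simps)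
    then have "bounded (range W)" by (auto simp: bounded_iff)
    then obtain w r where r: "strict_mono r" and W: "(W \<circ> r) \<longlonglongrightarrow> w"
      using bounded_imp_convergent_subsequence[of W] by blast
    have W_mem: "\<phi> z + t k *\<^sub>R W k = \<phi> (z + h k)" for k using t[of k] by (simp add: W_def)
    have tr: "(t \<circ> r) \<longlonglongrightarrow> 0" using t0 r by (rule LIMSEQ_subseq_LIMSEQ)
    have "w \<in> T" unfolding T_def contingent_cone_def
      using W tr t by (intro CollectI exI[of _ "t \<circ> r"] exI[of _ "W \<circ> r"]) (auto simp: W_mem)
    then have Aw: "A (\<psi> w) = w" by (intro A_eq) simp_all
    have \<psi>W: "\<psi> (W k) = (1 / t k) *\<^sub>R h k" for k by (simp add: W_def \<psi>.scaleR \<psi>.diff inv)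
    have "(\<lambda>k. norm ((W \<circ> r) k - A (\<psi> ((W \<circ> r) k)))) \<longlonglongrightarrow> norm (w - A (\<psi> w))"
      by (intro tendsto_norm tendsto_diff A.tendsto \<psi>.tendsto W)
    moreover have "e \<le> norm ((W \<circ> r) k - A (\<psi> ((W \<circ> r) k)))" for k
    proof -
      have "W (r k) - A (\<psi> (W (r k))) = (1 / t (r k)) *\<^sub>R (\<phi> (z + h (r k)) - \<phi> z - A (h (r k)))"
        unfolding \<psi>W by (simp add: W_def A.scaleR scaleR_diff_right)
      then show ?thesis using h(3)[of "r k"] t[of "r k"] by (simp add: t_def)
    qed
    ultimately have "e \<le> norm (w - A (\<psi> w))" by (intro LIMSEQ_le_const) auto
    with Aw e show False by simp
  qed
  then show ?thesis by (auto simp: differentiable_def)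
qed

lemma has_derivative_norm_le:
  assumes f: "(f has_derivative f') (at z)" and lip: "\<And>x y. norm (f x - f y) \<le> C * norm (x - y)"
  shows "norm (f' h) \<le> C * norm h"
proof -
  have t: "\<And>k. inverse (real (Suc k)) > 0" by simp
  have "norm ((1 / inverse (real (Suc k))) *\<^sub>R (f (z + inverse (real (Suc k)) *\<^sub>R h) - f z)) \<le> C * norm h" for k
  proof -
    have "norm (f (z + inverse (real (Suc k)) *\<^sub>R h) - f z) \<le> inverse (real (Suc k)) * (C * norm h)"
      using lip[of "z + inverse (real (Suc k)) *\<^sub>R h" z] by (simp add: mult_ac)
    then show ?thesis unfolding norm_scaleR by (simp add: field_simps del: of_nat_Suc)
  qed
  then show ?thesis
    by (intro LIMSEQ_le_const2[OF tendsto_norm[OF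
          has_derivative_directional_seq[OF f t LIMSEQ_inverse_real_of_nat tendsto_const]]]) auto
qed

section \<open>The Minty parametrization of the graph\<close>

text \<open>Lets the results on the sum map be reused for the subdifferential alone, by taking F =
  0.\<close>

lemma sum_map_zero: "sum_map (\<lambda>_. 0) q = subdiff q"
  by (simp add: sum_map_def fun_eq_iff)

definition minty :: "('a::euclidean_space \<Rightarrow> 'a) \<Rightarrow> ('a \<Rightarrow> ereal) \<Rightarrow> real \<Rightarrow> 'a \<Rightarrow> 'a \<times> 'a" where
  "minty F q \<gamma> z = (prox q \<gamma> z, \<gamma> *\<^sub>R (z - prox q \<gamma> z) + F (prox q \<gamma> z))"

text \<open>The derivative of \<open>minty\<close> when \<open>D\<close> is the derivative of
  \<open>prox\<close> and \<open>G\<close> that of \<open>F\<close> at the proximal point. Encoding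
  it as a bounded linear operator makes limits of tangent spaces accessible through operator-norm
  limits of \<open>D\<close> and \<open>G\<close>.\<close>

definition minty_deriv ::
  "real \<Rightarrow> ('a::euclidean_space \<Rightarrow>\<^sub>L 'a) \<Rightarrow> ('a \<Rightarrow>\<^sub>L 'a) \<Rightarrow> 'a \<Rightarrow>\<^sub>L ('a \<times> 'a)" where
  "minty_deriv \<gamma> D G = (Blinfun (\<lambda>x. (x, 0)) o\<^sub>L D)
     + (Blinfun (\<lambda>y. (0, y)) o\<^sub>L (\<gamma> *\<^sub>R (id_blinfun - D) + (G o\<^sub>L D)))"

lemma minty_deriv_apply:
  "blinfun_apply (minty_deriv \<gamma> D G) = (\<lambda>h. (D h, \<gamma> *\<^sub>R (h - D h) + G (D h)))"
proof -
  have "blinfun_apply (Blinfun (\<lambda>x::'a. (x, 0::'a))) = (\<lambda>x. (x, 0))"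
    "blinfun_apply (Blinfun (\<lambda>y::'a. (0::'a, y))) = (\<lambda>y. (0, y))"
    by (intro bounded_linear_Blinfun_apply bounded_linear_Pair bounded_linear_zero bounded_linear_ident)+
  then show ?thesis
    by (simp add: minty_deriv_def fun_eq_iff blinfun.add_left blinfun.diff_left blinfun.scaleR_left)
qed

lemma inj_minty_deriv:
  assumes "\<gamma> > 0"
  shows "inj (blinfun_apply (minty_deriv \<gamma> D G))"
proof (rule injI)
  fix h h' assume "minty_deriv \<gamma> D G h = minty_deriv \<gamma> D G h'"
  then have "D h = D h'" "\<gamma> *\<^sub>R (h - D h) = \<gamma> *\<^sub>R (h' - D h')" by (auto simp: minty_deriv_apply)
  then show "h = h'" using assms by simp
qed

lemma tendsto_minty_deriv:
  assumes "\<gamma>k \<longlonglongrightarrow> \<gamma>" "Dk \<longlonglongrightarrow> D" "Gk \<longlonglongrightarrow> G"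
  shows "(\<lambda>k. minty_deriv (\<gamma>k k) (Dk k) (Gk k)) \<longlonglongrightarrow> minty_deriv \<gamma> D G"
  unfolding minty_deriv_def by (intro tendsto_intros assms)

text \<open>Prepares a diagonal argument: along a sequence of Bouligand elements, each is replaced
  by a genuine derivative at a nearby point.\<close>

lemma bouligand_subdiff_approx:
  assumes "B \<in> bouligand_subdiff \<Psi> z" and "e > 0"
  obtains z' D where "(\<Psi> has_derivative blinfun_apply D) (at z')" "dist z' z < e" "dist D B < e"
proof -
  obtain Z D where Z: "Z \<longlonglongrightarrow> z" and D: "D \<longlonglongrightarrow> B"
    and der: "\<And>k::nat. (\<Psi> has_derivative blinfun_apply (D k)) (at (Z k))"
    using assms(1) unfolding bouligand_subdiff_def by blast
  have "\<forall>\<^sub>F k in sequentially. dist (Z k) z < e \<and> dist (D k) B < e"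
    using tendstoD[OF Z assms(2)] tendstoD[OF D assms(2)] by (rule eventually_conj)
  then obtain k where "dist (Z k) z < e" "dist (D k) B < e" using eventually_happens by force
  with der show thesis by (intro that)
qed

context prox_setting
begin

section \<open>The graph, its tangent cones and their limits through the Minty map\<close>

lemma minty_left_inverse:
  assumes "\<gamma> > 0"
  shows "fst (minty F q \<gamma> z) + (1 / \<gamma>) *\<^sub>R (snd (minty F q \<gamma> z) - F (fst (minty F q \<gamma> z))) = z"
  using assms by (simp add: minty_def)

lemma gph_sum_map:
  assumes "\<gamma> > 0"
  shows "gph (sum_map F q) = range (minty F q \<gamma>)"
proof (intro equalityI subsetI)
  fix p assume "p \<in> gph (sum_map F q)"
  then obtain w g where p: "p = (w, F w + g)" and g: "g \<in> subdiff q w"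
    by (auto simp: gph_def sum_map_def)
  have "minty F q \<gamma> (w + (1 / \<gamma>) *\<^sub>R g) = p"
    using assms by (simp add: minty_def prox_eqI[OF assms g] p)
  then show "p \<in> range (minty F q \<gamma>)" by (metis rangeI)
next
  fix p assume "p \<in> range (minty F q \<gamma>)"
  then obtain z where "p = minty F q \<gamma> z" by blast
  then show "p \<in> gph (sum_map F q)"
    using prox_subdiff[OF assms, of z] by (auto simp: minty_def gph_def sum_map_def intro: add.commute)
qed

lemma contingent_cone_sum_map:
  assumes "\<gamma> > 0" and F: "\<And>x. (F has_derivative blinfun_apply (F' x)) (at x)"
    and D: "(prox q \<gamma> has_derivative blinfun_apply D) (at z)"
  shows "contingent_cone (gph (sum_map F q)) (minty F q \<gamma> z)
    = range (blinfun_apply (minty_deriv \<gamma> D (F' (prox q \<gamma> z))))"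
  unfolding gph_sum_map[OF assms(1)]
proof (rule contingent_cone_range)
  show "(minty F q \<gamma> has_derivative minty_deriv \<gamma> D (F' (prox q \<gamma> z))) (at z)"
    unfolding minty_def minty_deriv_apply
    by (auto intro!: derivative_eq_intros D has_derivative_compose[OF D F])
  define w where "w = fst (minty F q \<gamma> z)"
  show "((\<lambda>p. fst p + (1 / \<gamma>) *\<^sub>R (snd p - F (fst p))) has_derivative
      (\<lambda>p. fst p + (1 / \<gamma>) *\<^sub>R (snd p - F' w (fst p)))) (at (minty F q \<gamma> z))"
    unfolding w_def
    by (auto intro!: derivative_eq_intros has_derivative_compose[OF has_derivative_fst[OF has_derivative_ident] F])
qed (rule minty_left_inverse[OF assms(1)])

lemma scd_hat_sum_map:
  assumes "\<gamma> > 0" and F: "\<And>x. (F has_derivative blinfun_apply (F' x)) (at x)"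
    and D: "(prox q \<gamma> has_derivative blinfun_apply D) (at z)"
  shows "adj_subspace (range (blinfun_apply (minty_deriv \<gamma> D (F' (prox q \<gamma> z)))))
    \<in> scd_hat (sum_map F q) (minty F q \<gamma> z)"
proof -
  have "minty F q \<gamma> z \<in> gph (sum_map F q)" by (simp add: gph_sum_map[OF assms(1)])
  then show ?thesis
    using range_in_Zn[OF inj_minty_deriv[OF assms(1)]]
    by (simp add: scd_hat_def contingent_cone_sum_map[OF assms])
qed

text \<open>The parameter may vary along the sequence, because the range of the Minty map is the
  same graph for every positive parameter. This is what later permits estimates uniform in the
  parameter.\<close>

lemma scd_deriv_sum_map_limit:
  assumes "\<gamma> > 0" and "\<And>k. \<gamma>k k > 0" and \<gamma>k: "\<gamma>k \<longlonglongrightarrow> \<gamma>"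
    and F: "\<And>x. (F has_derivative blinfun_apply (F' x)) (at x)" and F': "isCont F' w"
    and der: "\<And>k. (prox q (\<gamma>k k) has_derivative blinfun_apply (D k)) (at (Z k))"
    and D: "D \<longlonglongrightarrow> B" and lim: "(\<lambda>k. minty F q (\<gamma>k k) (Z k)) \<longlonglongrightarrow> (w, y)"
  shows "adj_subspace (range (blinfun_apply (minty_deriv \<gamma> B (F' w)))) \<in> scd_deriv (sum_map F q) (w, y)"
proof -
  have "(\<lambda>k. prox q (\<gamma>k k) (Z k)) \<longlonglongrightarrow> w" using tendsto_fst[OF lim] by (simp add: minty_def)
  then have "(\<lambda>k. F' (prox q (\<gamma>k k) (Z k))) \<longlonglongrightarrow> F' w" using F' by (rule isCont_tendsto_compose[rotated])
  from Zn_dist_adj_range_tendsto[OF tendsto_minty_deriv[OF \<gamma>k D this] inj_minty_deriv[OF assms(1)]]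
  moreover have "minty F q (\<gamma>k k) (Z k) \<in> gph (sum_map F q)" for k
    by (simp add: gph_sum_map[OF assms(2), of F k])
  ultimately show ?thesis
    unfolding scd_deriv_def using lim scd_hat_sum_map[OF assms(2) F der]
    by (auto intro!: adj_subspace_in_Zn range_in_Zn inj_minty_deriv assms(1)
        exI[of _ "\<lambda>k. minty F q (\<gamma>k k) (Z k)"]
        exI[of _ "\<lambda>k. adj_subspace (range (blinfun_apply (minty_deriv (\<gamma>k k) (D k) (F' (prox q (\<gamma>k k) (Z k))))))"])
qed

text \<open>The first component contributes 1 and the second \<gamma>(1 + 1), both by
  nonexpansiveness. The case F = 0 is singled out since a continuously differentiable
  \<open>F\<close> may fail to be globally Lipschitz.\<close>

lemma minty_zero_lipschitz:
  assumes "\<gamma> > 0"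
  shows "norm (minty (\<lambda>_. 0) q \<gamma> z - minty (\<lambda>_. 0) q \<gamma> z') \<le> (1 + 2 * \<gamma>) * norm (z - z')"
proof -
  define p where "p = prox q \<gamma> z - prox q \<gamma> z'"
  have p: "norm p \<le> norm (z - z')" unfolding p_def by (rule prox_nonexpansive[OF assms])
  have "minty (\<lambda>_. 0) q \<gamma> z - minty (\<lambda>_. 0) q \<gamma> z' = (p, \<gamma> *\<^sub>R ((z - z') - p))"
    by (simp add: minty_def p_def algebra_simps)
  also have "norm \<dots> \<le> norm p + norm (\<gamma> *\<^sub>R ((z - z') - p))" by (rule norm_Pair_le)
  also have "norm (\<gamma> *\<^sub>R ((z - z') - p)) = \<gamma> * norm ((z - z') - p)" using assms by simp
  also have "\<dots> \<le> \<gamma> * (norm (z - z') + norm (z - z'))"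
    using assms p norm_triangle_ineq4[of "z - z'" p] by (intro mult_left_mono) auto
  finally show ?thesis using p by (simp add: algebra_simps)
qed

section \<open>From SCD information on the subdifferential back to derivatives of the proximal
  map\<close>

lemma prox_has_derivative_norm_le:
  assumes "\<gamma> > 0" and "(prox q \<gamma> has_derivative blinfun_apply D) (at z)"
  shows "norm D \<le> 1"
  using has_derivative_norm_le[OF assms(2), of 1] prox_nonexpansive[OF assms(1)]
  by (intro norm_blinfun_bound) auto

lemma bouligand_prox_norm_le:
  assumes "\<gamma> > 0" and "B \<in> bouligand_subdiff (prox q \<gamma>) z"
  shows "norm B \<le> 1"
proof -
  obtain Z D where D: "D \<longlonglongrightarrow> B"
    and der: "\<And>k::nat. (prox q \<gamma> has_derivative blinfun_apply (D k)) (at (Z k))"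
    using assms(2) unfolding bouligand_subdiff_def by blast
  show ?thesis
    by (rule LIMSEQ_le_const2[OF tendsto_norm[OF D]])
      (use prox_has_derivative_norm_le[OF assms(1) der] in blast)
qed

text \<open>For F = 0 the Minty map is Lipschitz with a linear left inverse, so a tangent cone in
  \<open>Zn\<close> makes it differentiable; \<open>prox\<close> is its first component.\<close>

lemma scd_hat_imp_prox_differentiable:
  assumes "\<gamma> > 0" and "scd_hat (subdiff q) p \<noteq> {}"
  shows "\<exists>D. (prox q \<gamma> has_derivative blinfun_apply D) (at (fst p + (1 / \<gamma>) *\<^sub>R snd p))"
proof -
  define \<phi> where "\<phi> = minty (\<lambda>_. 0) q \<gamma>"
  have gph: "gph (subdiff q) = range \<phi>"
    using gph_sum_map[OF assms(1), of "\<lambda>_. 0"] by (simp add: sum_map_zero \<phi>_def)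
  have "p \<in> range \<phi>" and cone: "contingent_cone (range \<phi>) p \<in> Zn"
    using assms(2) by (auto simp: scd_hat_def gph split: if_splits)
  then obtain z where z: "p = \<phi> z" by blast
  have inv: "fst (\<phi> x) + (1 / \<gamma>) *\<^sub>R snd (\<phi> x) = x" for x
    using minty_left_inverse[OF assms(1), of "\<lambda>_. 0"] by (simp add: \<phi>_def)
  have "bounded_linear (\<lambda>p::'a \<times> 'a. fst p + (1 / \<gamma>) *\<^sub>R snd p)"
    by (intro bounded_linear_add bounded_linear_fst bounded_linear_const_scaleR bounded_linear_snd)
  then have "\<phi> differentiable (at z)"
    using contingent_cone_range_Zn_imp_differentiable[OF minty_zero_lipschitz[OF assms(1)], of _ z] inv cone
    unfolding \<phi>_def z by blast
  then obtain A where "(\<phi> has_derivative A) (at z)" by (auto simp: differentiable_def)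
  then have "((\<lambda>x. fst (\<phi> x)) has_derivative (\<lambda>h. fst (A h))) (at z)" by (rule has_derivative_fst)
  then have der: "(prox q \<gamma> has_derivative (\<lambda>h. fst (A h))) (at z)" by (simp add: \<phi>_def minty_def)
  then have "blinfun_apply (Blinfun (\<lambda>h. fst (A h))) = (\<lambda>h. fst (A h))"
    by (intro bounded_linear_Blinfun_apply has_derivative_bounded_linear)
  with der show ?thesis unfolding z inv by metis
qed

text \<open>The graph points that witness a nonempty SCD derivative correspond to points of
  differentiability of \<open>prox\<close>. Nonexpansiveness bounds the derivatives there by 1, so a
  subsequence of them converges.\<close>

lemma scd_deriv_imp_bouligand_nonempty:
  assumes "\<gamma> > 0" and "scd_deriv (subdiff q) p \<noteq> {}"
  shows "bouligand_subdiff (prox q \<gamma>) (fst p + (1 / \<gamma>) *\<^sub>R snd p) \<noteq> {}"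
proof -
  obtain Z where Z: "Z \<longlonglongrightarrow> p" and hat: "\<And>k::nat. scd_hat (subdiff q) (Z k) \<noteq> {}"
    using assms(2) unfolding scd_deriv_def by blast
  define z where "z = (\<lambda>k. fst (Z k) + (1 / \<gamma>) *\<^sub>R snd (Z k))"
  have "\<forall>k. \<exists>D. (prox q \<gamma> has_derivative blinfun_apply D) (at (z k))"
    unfolding z_def using scd_hat_imp_prox_differentiable[OF assms(1) hat] by blast
  then obtain D where D: "\<And>k. (prox q \<gamma> has_derivative blinfun_apply (D k)) (at (z k))" by metis
  have "bounded (range D)" using prox_has_derivative_norm_le[OF assms(1) D] by (auto simp: bounded_iff)
  then obtain B r where r: "strict_mono r" and B: "(D \<circ> r) \<longlonglongrightarrow> B"
    using bounded_imp_convergent_subsequence by blast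
  have "z \<longlonglongrightarrow> fst p + (1 / \<gamma>) *\<^sub>R snd p" unfolding z_def by (intro tendsto_intros Z)
  then have "(z \<circ> r) \<longlonglongrightarrow> fst p + (1 / \<gamma>) *\<^sub>R snd p" using r by (rule LIMSEQ_subseq_LIMSEQ)
  then have "B \<in> bouligand_subdiff (prox q \<gamma>) (fst p + (1 / \<gamma>) *\<^sub>R snd p)"
    unfolding bouligand_subdiff_def using B D
    by (intro CollectI exI[of _ "z \<circ> r"] exI[of _ "D \<circ> r"]) auto
  then show ?thesis by blast
qed

text \<open>The test pair is built from the error \<open>r\<close> itself, so that the left side of
  the semismooth* inequality becomes the square of \<open>norm r\<close>, while the right side is
  linear in \<open>norm r\<close>; one factor cancels.\<close>

lemma bouligand_prox_semismooth_bound: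
  assumes "\<gamma> > 0" and B: "B \<in> bouligand_subdiff (prox q \<gamma>) z"
    and semi: "\<And>xs ys. (ys, xs) \<in> \<Union> (scd_deriv (subdiff q) (minty (\<lambda>_. 0) q \<gamma> z)) \<Longrightarrow>
      \<bar>xs \<bullet> (fst (minty (\<lambda>_. 0) q \<gamma> z) - fst (minty (\<lambda>_. 0) q \<gamma> z'))
        - ys \<bullet> (snd (minty (\<lambda>_. 0) q \<gamma> z) - snd (minty (\<lambda>_. 0) q \<gamma> z'))\<bar>
      \<le> \<epsilon> * norm (minty (\<lambda>_. 0) q \<gamma> z - minty (\<lambda>_. 0) q \<gamma> z') * norm (xs, ys)"
    and "\<epsilon> \<ge> 0"
  shows "norm (prox q \<gamma> z - prox q \<gamma> z' - B (z - z')) \<le> \<epsilon> * (1 + 2 * \<gamma>) * (2 + 1 / \<gamma>) * norm (z - z')"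
proof -
  obtain Z D where Z: "Z \<longlonglongrightarrow> z" and D: "D \<longlonglongrightarrow> B"
    and der: "\<And>k::nat. (prox q \<gamma> has_derivative blinfun_apply (D k)) (at (Z k))"
    using B unfolding bouligand_subdiff_def by blast
  define \<phi> where "\<phi> = minty (\<lambda>_. 0) q \<gamma>"
  have "(\<lambda>k. norm (\<phi> (Z k) - \<phi> z)) \<longlonglongrightarrow> 0"
  proof (rule tendsto_sandwich[OF _ _ tendsto_const])
    show "\<forall>\<^sub>F k in sequentially. norm (\<phi> (Z k) - \<phi> z) \<le> (1 + 2 * \<gamma>) * norm (Z k - z)"
      unfolding \<phi>_def using minty_zero_lipschitz[OF assms(1)] by simp
    have "(\<lambda>k. (1 + 2 * \<gamma>) * norm (Z k - z)) \<longlonglongrightarrow> (1 + 2 * \<gamma>) * norm (z - z)" by (intro tendsto_intros Z)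
    then show "(\<lambda>k. (1 + 2 * \<gamma>) * norm (Z k - z)) \<longlonglongrightarrow> 0" by simp
  qed simp
  then have "(\<lambda>k. \<phi> (Z k)) \<longlonglongrightarrow> (fst (\<phi> z), snd (\<phi> z))" by (simp add: tendsto_norm_zero_iff LIM_zero_iff)
  then have "adj_subspace (range (blinfun_apply (minty_deriv \<gamma> B 0)))
      \<in> scd_deriv (sum_map (\<lambda>_. 0) q) (fst (\<phi> z), snd (\<phi> z))"
    using der D assms(1) unfolding \<phi>_def
    by (intro scd_deriv_sum_map_limit[where F' = "\<lambda>_. 0" and \<gamma>k = "\<lambda>_. \<gamma>"])
      (auto simp: zero_blinfun.rep_eq)
  then have mem: "adj_subspace (range (blinfun_apply (minty_deriv \<gamma> B 0))) \<in> scd_deriv (subdiff q) (\<phi> z)"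
    by (simp add: sum_map_zero)
  define r where "r = prox q \<gamma> z - prox q \<gamma> z' - B (z - z')"
  define a where "a = adjoint (blinfun_apply B) r"
  have a: "x \<bullet> a = B x \<bullet> r" for x
    unfolding a_def by (rule adjoint_works) (simp add: bounded_linear.linear blinfun.bounded_linear_right)
  have a_le: "norm a \<le> norm r"
  proof -
    have "norm a * norm a = B a \<bullet> r" using a[of a] by (simp add: power2_norm_eq_inner flip: power2_eq_square)
    also have "\<dots> \<le> norm (B a) * norm r" by (rule norm_cauchy_schwarz)
    also have "norm (B a) \<le> 1 * norm a"
      by (rule order_trans[OF norm_blinfun mult_right_mono[OF bouligand_prox_norm_le[OF assms(1) B]]]) simp
    then have "norm (B a) * norm r \<le> norm a * norm r" by (intro mult_right_mono) auto
    finally show ?thesis by (metis mult_le_cancel_left_pos norm_ge_zero order.order_iff_strict)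
  qed
  \<comment> \<open>With \<open>a\<close> the transpose of \<open>B\<close> applied to
    \<open>r\<close>, the inner products of \<open>r\<close> with \<open>B h\<close> and of
    \<open>a\<close> with \<open>h\<close> agree; subtracting that of \<open>a\<close> with
    \<open>B h\<close> gives the relation defining the adjoint subspace.\<close>
  have "((1 / \<gamma>) *\<^sub>R a, r - a) \<in> adj_subspace (range (blinfun_apply (minty_deriv \<gamma> B 0)))"
  proof -
    have "(r - a) \<bullet> B h = a \<bullet> (h - B h)" for h
      using a[of h] a[of "B h"] by (simp add: inner_diff_left inner_diff_right inner_commute)
    then show ?thesis unfolding adj_subspace_iff minty_deriv_apply using assms(1) by auto
  qed
  then have "((1 / \<gamma>) *\<^sub>R a, r - a) \<in> \<Union> (scd_deriv (subdiff q) (minty (\<lambda>_. 0) q \<gamma> z))"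
    using mem by (auto simp: \<phi>_def)
  from semi[OF this]
  have "\<bar>(r - a) \<bullet> (prox q \<gamma> z - prox q \<gamma> z')
        - ((1 / \<gamma>) *\<^sub>R a) \<bullet> (\<gamma> *\<^sub>R (z - prox q \<gamma> z) - \<gamma> *\<^sub>R (z' - prox q \<gamma> z'))\<bar>
      \<le> \<epsilon> * norm (\<phi> z - \<phi> z') * norm (r - a, (1 / \<gamma>) *\<^sub>R a)"
    by (simp add: minty_def \<phi>_def)
  \<comment> \<open>The factor \<gamma> of the second graph coordinate cancels 1/\<gamma>, and the
    two products of \<open>a\<close> with the difference of proximal points cancel each
    other.\<close>
  also have "(r - a) \<bullet> (prox q \<gamma> z - prox q \<gamma> z')
        - ((1 / \<gamma>) *\<^sub>R a) \<bullet> (\<gamma> *\<^sub>R (z - prox q \<gamma> z) - \<gamma> *\<^sub>R (z' - prox q \<gamma> z'))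
      = r \<bullet> (prox q \<gamma> z - prox q \<gamma> z') - (z - z') \<bullet> a"
  proof -
    have eq: "((1 / \<gamma>) *\<^sub>R a) \<bullet> (\<gamma> *\<^sub>R w - \<gamma> *\<^sub>R w') = (w - w') \<bullet> a" for w w'
      using assms(1) by (simp add: inner_commute flip: scaleR_diff_right)
    show ?thesis unfolding eq by (simp add: inner_diff_left inner_diff_right inner_commute)
  qed
  also have "\<dots> = r \<bullet> (prox q \<gamma> z - prox q \<gamma> z' - B (z - z'))"
    unfolding a by (simp add: inner_diff_right inner_commute)
  also have "\<dots> = r \<bullet> r" by (simp only: r_def[symmetric])
  \<comment> \<open>The factor 1 + 2\<gamma> is the Lipschitz constant of the Minty map; 2 +
    1/\<gamma> bounds the test pair, since \<open>a\<close> is no longer than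
    \<open>r\<close>.\<close>
  also have "\<epsilon> * norm (\<phi> z - \<phi> z') * norm (r - a, (1 / \<gamma>) *\<^sub>R a)
      \<le> \<epsilon> * ((1 + 2 * \<gamma>) * norm (z - z')) * ((2 + 1 / \<gamma>) * norm r)"
  proof (intro mult_mono order_refl)
    have "norm (r - a, (1 / \<gamma>) *\<^sub>R a) \<le> norm (r - a) + norm ((1 / \<gamma>) *\<^sub>R a)" by (rule norm_Pair_le)
    also have "norm (r - a) \<le> 2 * norm r" using norm_triangle_ineq4[of r a] a_le by simp
    also have "norm ((1 / \<gamma>) *\<^sub>R a) \<le> (1 / \<gamma>) * norm r" using a_le assms(1) by (simp add: divide_right_mono)
    finally show "norm (r - a, (1 / \<gamma>) *\<^sub>R a) \<le> (2 + 1 / \<gamma>) * norm r" by (simp add: distrib_right)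
    show "norm (\<phi> z - \<phi> z') \<le> (1 + 2 * \<gamma>) * norm (z - z')"
      unfolding \<phi>_def by (rule minty_zero_lipschitz[OF assms(1)])
  qed (use \<open>\<epsilon> \<ge> 0\<close> assms(1) in auto)
  finally have "norm r * norm r \<le> (\<epsilon> * (1 + 2 * \<gamma>) * (2 + 1 / \<gamma>) * norm (z - z')) * norm r"
    by (simp add: mult_ac power2_norm_eq_inner flip: power2_eq_square)
  moreover have "0 \<le> \<epsilon> * (1 + 2 * \<gamma>) * (2 + 1 / \<gamma>) * norm (z - z')" using \<open>\<epsilon> \<ge> 0\<close> assms(1) by simp
  ultimately show ?thesis unfolding r_def[symmetric]
    by (metis mult_right_le_imp_le norm_ge_zero order.order_iff_strict)
qed

end

section \<open>Local convergence of the Newton method\<close>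

text \<open>Regularity says that only 0 is orthogonal to the range of \<open>M\<close>, the second
  component of the tangent parametrization. So \<open>M\<close> is onto, hence injective, and a
  kernel vector of the Newton map yields a kernel vector of \<open>M\<close>.\<close>

lemma newton_map_kernel_trivial:
  fixes B G :: "'a::euclidean_space \<Rightarrow>\<^sub>L 'a"
  assumes "\<gamma> > 0"
    and reg: "\<And>ys. (ys, 0) \<in> adj_subspace (range (blinfun_apply (minty_deriv \<gamma> B G))) \<Longrightarrow> ys = 0"
    and ker: "((B o\<^sub>L (id_blinfun - (1 / \<gamma>) *\<^sub>R G)) - id_blinfun) d = 0"
  shows "d = 0"
proof -
  define M where "M = (\<lambda>h. \<gamma> *\<^sub>R (h - B h) + G (B h))"
  have "linear M" unfolding M_def
    by (rule linearI) (simp_all add: blinfun.add_right blinfun.scaleR_right algebra_simps)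
  have "surj M"
  proof (rule ccontr)
    assume "\<not> surj M"
    moreover have "span (range M) = range M"
      using linear_subspace_image[OF \<open>linear M\<close> subspace_UNIV] by (simp only: span_eq_iff)
    ultimately obtain ys where "ys \<noteq> 0" and ys: "\<And>h. ys \<bullet> M h = 0"
      using span_not_UNIV_orthogonal[of "range M"] by (metis rangeI)
    then have "(ys, 0) \<in> adj_subspace (range (blinfun_apply (minty_deriv \<gamma> B G)))"
      unfolding adj_subspace_iff minty_deriv_apply using ys by (auto simp: M_def)
    with reg \<open>ys \<noteq> 0\<close> show False by blast
  qed
  then have "inj M" by (rule linear_surjective_imp_injective[OF \<open>linear M\<close>]) (rule refl)
  \<comment> \<open>The kernel equation reads \<open>B h = d\<close>, and then M h = \<gamma>(h - d)
    + G d = 0 by the choice of \<open>h\<close>.\<close>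
  define h where "h = d - (1 / \<gamma>) *\<^sub>R G d"
  have Bh: "B h = d" using ker by (simp add: h_def blinfun.diff_left blinfun.scaleR_left)
  then have "M h = 0" using assms(1) by (simp add: M_def h_def)
  then have "h = 0" using \<open>inj M\<close> linear_0[OF \<open>linear M\<close>] by (metis injD)
  with Bh show ?thesis by simp
qed

locale newton_setting =
  fixes F :: "'a::euclidean_space \<Rightarrow> 'a" and F' :: "'a \<Rightarrow> 'a \<Rightarrow>\<^sub>L 'a"
    and q :: "'a \<Rightarrow> ereal" and xb :: 'a and \<gamma>lo \<gamma>hi :: real
  assumes F: "\<And>x. (F has_derivative blinfun_apply (F' x)) (at x)"
    and F'_cont: "continuous_on UNIV F'"
    and q: "closed_proper_convex q"
    and sol: "0 \<in> sum_map F q xb"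
    and semi: "scd_semismooth (subdiff q) (xb, - F xb)"
    and reg: "scd_regular (sum_map F q) (xb, 0)"
    and \<gamma>: "0 < \<gamma>lo" "\<gamma>lo \<le> \<gamma>hi"
begin

section \<open>The forward step and estimates near the solution that are uniform in the
  parameter\<close>

lemma sol_subdiff: "- F xb \<in> subdiff q xb"
proof -
  obtain g where "g \<in> subdiff q xb" "F xb + g = 0" using sol by (auto simp: sum_map_def)
  then show ?thesis by (metis add_eq_0_iff)
qed

sublocale prox_setting q
  using q sol_subdiff by unfold_locales auto

definition fwd :: "real \<Rightarrow> 'a \<Rightarrow> 'a" where
  "fwd g x = x - (1 / g) *\<^sub>R F x"

lemma \<gamma>_pos: "g \<in> {\<gamma>lo..\<gamma>hi} \<Longrightarrow> g > 0"
  using \<gamma> by simp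

lemma prox_fwd_sol: "g > 0 \<Longrightarrow> prox q g (fwd g xb) = xb"
  using prox_eqI[OF _ sol_subdiff] by (simp add: fwd_def)

lemma isCont_F: "isCont F x"
  using F has_derivative_continuous by blast

lemma isCont_F': "isCont F' x"
  using F'_cont by (simp add: continuous_on_eq_continuous_at)

lemma norm_fwd_diff:
  assumes "g \<in> {\<gamma>lo..\<gamma>hi}"
  shows "norm (fwd g x - fwd g xb) \<le> norm (x - xb) + (1 / \<gamma>lo) * norm (F x - F xb)"
proof -
  have "fwd g x - fwd g xb = (x - xb) - (1 / g) *\<^sub>R (F x - F xb)"
    by (simp add: fwd_def scaleR_diff_right)
  also have "norm \<dots> \<le> norm (x - xb) + norm ((1 / g) *\<^sub>R (F x - F xb))" by (rule norm_triangle_ineq4)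
  also have "norm ((1 / g) *\<^sub>R (F x - F xb)) = (1 / g) * norm (F x - F xb)" using \<gamma>_pos[OF assms] by simp
  also have "\<dots> \<le> (1 / \<gamma>lo) * norm (F x - F xb)"
    using assms \<gamma> by (intro mult_right_mono frac_le) auto
  finally show ?thesis by simp
qed

lemma newton_maps_alt:
  "newton_maps F F' q g x = {(B o\<^sub>L (id_blinfun - (1 / g) *\<^sub>R F' x)) - id_blinfun | B.
     B \<in> bouligand_subdiff (prox q g) (fwd g x)}"
  by (simp add: newton_maps_def fwd_def)

lemma eventually_norm_lt:
  assumes "isCont f xb" and "e > 0"
  shows "\<forall>\<^sub>F x in nhds xb. norm (f x - f xb) < e"
  using tendstoD[of f "f xb" "nhds xb" e] assms tendsto_nhds_iff[of f "f xb" xb]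
  by (simp add: isCont_def dist_norm)

lemma eventually_F_linearization:
  assumes "e > 0"
  shows "\<forall>\<^sub>F x in nhds xb. norm (F x - F xb - F' xb (x - xb)) \<le> e * norm (x - xb)"
proof -
  have "\<exists>d>0. \<forall>y. norm (y - xb) < d \<longrightarrow> norm (F y - F xb - F' xb (y - xb)) \<le> e * norm (y - xb)"
    using F[of xb] assms unfolding has_derivative_at_alt by blast
  then show ?thesis by (auto simp: eventually_nhds_metric dist_norm)
qed

lemma norm_minty_fwd_diff:
  assumes "g \<in> {\<gamma>lo..\<gamma>hi}"
  shows "norm (minty (\<lambda>_. 0) q g (fwd g x) - (xb, - F xb))
    \<le> (1 + 2 * \<gamma>hi) * (norm (x - xb) + (1 / \<gamma>lo) * norm (F x - F xb))"
proof -
  have "minty (\<lambda>_. 0) q g (fwd g xb) = (xb, - F xb)"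
    using \<gamma>_pos[OF assms] unfolding minty_def prox_fwd_sol[OF \<gamma>_pos[OF assms]] by (simp add: fwd_def)
  then have "norm (minty (\<lambda>_. 0) q g (fwd g x) - (xb, - F xb)) \<le> (1 + 2 * g) * norm (fwd g x - fwd g xb)"
    using minty_zero_lipschitz[OF \<gamma>_pos[OF assms]] by metis
  also have "\<dots> \<le> (1 + 2 * \<gamma>hi) * (norm (x - xb) + (1 / \<gamma>lo) * norm (F x - F xb))"
    using assms \<gamma> norm_fwd_diff[OF assms] by (intro mult_mono) auto
  finally show ?thesis .
qed

text \<open>Transfers properties near \<open>(xb, - F xb)\<close> to points near \<open>xb\<close>.
  For every parameter the Minty map sends \<open>fwd g xb\<close> to that pair, and the distance
  bound contains only \<open>\<gamma>lo\<close> and \<open>\<gamma>hi\<close>, so one neighborhood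
  serves the whole interval.\<close>

lemma eventually_minty_fwd:
  assumes "\<forall>\<^sub>F p in nhds (xb, - F xb). P p"
  shows "\<forall>\<^sub>F x in nhds xb. \<forall>g\<in>{\<gamma>lo..\<gamma>hi}. P (minty (\<lambda>_. 0) q g (fwd g x))"
proof -
  obtain e where e: "e > 0" "\<And>p. dist p (xb, - F xb) < e \<Longrightarrow> P p"
    using assms by (auto simp: eventually_nhds_metric)
  define bound where "bound = (\<lambda>x. (1 + 2 * \<gamma>hi) * (norm (x - xb) + (1 / \<gamma>lo) * norm (F x - F xb)))"
  have "isCont bound xb" unfolding bound_def by (intro continuous_intros isCont_F)
  from eventually_norm_lt[OF this e(1)] have "\<forall>\<^sub>F x in nhds xb. bound x < e"
    by eventually_elim (simp add: bound_def)
  then show ?thesis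
  proof eventually_elim
    case (elim x)
    show ?case
    proof
      fix g assume "g \<in> {\<gamma>lo..\<gamma>hi}"
      from norm_minty_fwd_diff[OF this, of x] elim
      show "P (minty (\<lambda>_. 0) q g (fwd g x))" by (intro e(2)) (simp add: bound_def dist_norm)
    qed
  qed
qed

text \<open>The SCD property contained in semismoothness* holds at the graph point whose Minty
  parameter is \<open>fwd g x\<close>, and thus yields a Bouligand element there.\<close>

lemma eventually_newton_maps_nonempty:
  "\<forall>\<^sub>F x in nhds xb. \<forall>g\<in>{\<gamma>lo..\<gamma>hi}. newton_maps F F' q g x \<noteq> {}"
proof -
  have "\<forall>\<^sub>F p in nhds (xb, - F xb). p \<in> gph (subdiff q) \<longrightarrow> scd_deriv (subdiff q) p \<noteq> {}"
    using semi by (simp add: scd_semismooth_def scd_property_def)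
  from eventually_minty_fwd[OF this] show ?thesis
  proof eventually_elim
    case (elim x)
    show ?case
    proof
      fix g assume g: "g \<in> {\<gamma>lo..\<gamma>hi}"
      define p where "p = minty (\<lambda>_. 0) q g (fwd g x)"
      have "p \<in> gph (subdiff q)"
        using gph_sum_map[OF \<gamma>_pos[OF g], of "\<lambda>_. 0"] by (simp add: sum_map_zero p_def)
      then have "bouligand_subdiff (prox q g) (fst p + (1 / g) *\<^sub>R snd p) \<noteq> {}"
        using elim g by (intro scd_deriv_imp_bouligand_nonempty \<gamma>_pos) (auto simp: p_def)
      moreover have "fst p + (1 / g) *\<^sub>R snd p = fwd g x"
        using minty_left_inverse[OF \<gamma>_pos[OF g], of "\<lambda>_. 0"] by (simp add: p_def)
      ultimately show "newton_maps F F' q g x \<noteq> {}" by (auto simp: newton_maps_alt)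
    qed
  qed
qed

lemma eventually_prox_semismooth:
  assumes "e > 0"
  shows "\<forall>\<^sub>F x in nhds xb. \<forall>g\<in>{\<gamma>lo..\<gamma>hi}. \<forall>B\<in>bouligand_subdiff (prox q g) (fwd g x).
    norm (prox q g (fwd g x) - xb - B (fwd g x - fwd g xb)) \<le> e * norm (fwd g x - fwd g xb)"
proof -
  \<comment> \<open>\<open>K\<close> dominates the constant (1 + 2g)(2 + 1/g) of the semismoothness
    bound for all parameters \<open>g\<close> in the interval; hence \<epsilon> = e/K.\<close>
  define K where "K = (1 + 2 * \<gamma>hi) * (2 + 1 / \<gamma>lo)"
  have K: "K > 0" using \<gamma> by (auto simp: K_def intro!: mult_pos_pos add_pos_pos)
  define \<epsilon> where "\<epsilon> = e / K"
  have "\<epsilon> > 0" using assms K by (simp add: \<epsilon>_def)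
  then obtain \<delta> where "\<delta> > 0" and \<delta>: "\<And>x y xs ys. (x, y) \<in> gph (subdiff q) \<Longrightarrow> dist (x, y) (xb, - F xb) \<le> \<delta> \<Longrightarrow>
      (ys, xs) \<in> \<Union> (scd_deriv (subdiff q) (x, y)) \<Longrightarrow>
      \<bar>xs \<bullet> (x - xb) - ys \<bullet> (y - (- F xb))\<bar> \<le> \<epsilon> * norm ((x, y) - (xb, - F xb)) * norm (xs, ys)"
    using semi unfolding scd_semismooth_def fst_conv snd_conv by meson
  have "\<forall>\<^sub>F p in nhds (xb, - F xb). dist p (xb, - F xb) \<le> \<delta>"
    using \<open>\<delta> > 0\<close> by (auto simp: eventually_nhds_metric intro: less_imp_le)
  from eventually_minty_fwd[OF this] show ?thesis
  proof eventually_elim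
    case (elim x)
    show ?case
    proof (intro ballI)
      fix g B assume g: "g \<in> {\<gamma>lo..\<gamma>hi}" and B: "B \<in> bouligand_subdiff (prox q g) (fwd g x)"
      note g0 = \<gamma>_pos[OF g]
      obtain w y where wy: "minty (\<lambda>_. 0) q g (fwd g x) = (w, y)" by fastforce
      have gph: "(w, y) \<in> gph (subdiff q)"
        using gph_sum_map[OF g0, of "\<lambda>_. 0"] by (simp add: sum_map_zero flip: wy)
      have b: "minty (\<lambda>_. 0) q g (fwd g xb) = (xb, - F xb)"
        using g0 unfolding minty_def prox_fwd_sol[OF g0] by (simp add: fwd_def)
      have "norm (prox q g (fwd g x) - prox q g (fwd g xb) - B (fwd g x - fwd g xb))
          \<le> \<epsilon> * (1 + 2 * g) * (2 + 1 / g) * norm (fwd g x - fwd g xb)"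
      proof (rule bouligand_prox_semismooth_bound[OF g0 B])
        fix xs ys assume "(ys, xs) \<in> \<Union> (scd_deriv (subdiff q) (minty (\<lambda>_. 0) q g (fwd g x)))"
        moreover have "dist (w, y) (xb, - F xb) \<le> \<delta>" using elim g wy by metis
        ultimately show "\<bar>xs \<bullet> (fst (minty (\<lambda>_. 0) q g (fwd g x)) - fst (minty (\<lambda>_. 0) q g (fwd g xb))) -
            ys \<bullet> (snd (minty (\<lambda>_. 0) q g (fwd g x)) - snd (minty (\<lambda>_. 0) q g (fwd g xb)))\<bar>
            \<le> \<epsilon> * norm (minty (\<lambda>_. 0) q g (fwd g x) - minty (\<lambda>_. 0) q g (fwd g xb)) * norm (xs, ys)"
          unfolding wy b fst_conv snd_conv by (intro \<delta>[OF gph])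
      qed (use \<open>\<epsilon> > 0\<close> in simp)
      also have "\<epsilon> * (1 + 2 * g) * (2 + 1 / g) \<le> \<epsilon> * (1 + 2 * \<gamma>hi) * (2 + 1 / \<gamma>lo)"
        using g \<gamma> \<open>\<epsilon> > 0\<close> by (intro mult_mono add_mono frac_le) auto
      also have "\<dots> = \<epsilon> * K" by (simp add: K_def)
      also have "\<dots> = e" using K by (simp add: \<epsilon>_def)
      finally show "norm (prox q g (fwd g x) - xb - B (fwd g x - fwd g xb)) \<le> e * norm (fwd g x - fwd g xb)"
        unfolding prox_fwd_sol[OF g0] by (simp add: mult_right_mono)
    qed
  qed
qed

text \<open>The error splits into the semismoothness error of \<open>prox\<close> between the two
  forward points and \<open>B\<close> applied to the linearization error of \<open>F\<close>. Both
  are o(|x - xb|) uniformly in the parameter, and each receives half of \<open>e\<close>.\<close>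

lemma eventually_newton_residual:
  assumes "e > 0"
  shows "\<forall>\<^sub>F x in nhds xb. \<forall>g\<in>{\<gamma>lo..\<gamma>hi}. \<forall>V\<in>newton_maps F F' q g x.
    norm (V (x - xb) - prox_residual F q g x) \<le> e * norm (x - xb)"
proof -
  \<comment> \<open>\<open>C\<close> is a local Lipschitz constant of the forward step at
    \<open>xb\<close>, with \<open>norm (F' xb) + 1\<close> as that of \<open>F\<close>. The quarter
    in \<eta> below allows for two linearization terms, each bounded by \<eta>|d|.\<close>
  define C where "C = 1 + (1 / \<gamma>lo) * (norm (F' xb) + 1)"
  have C: "C > 0" using \<gamma> by (auto simp: C_def intro!: add_pos_nonneg)
  define \<eta> where "\<eta> = \<gamma>lo * e / 4"
  have "\<eta> > 0" using \<gamma> assms by (simp add: \<eta>_def)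
  have "e / 2 / C > 0" using C assms by simp
  from eventually_prox_semismooth[OF this] eventually_F_linearization[OF \<open>\<eta> > 0\<close>]
    eventually_F_linearization[of 1, simplified] eventually_norm_lt[OF isCont_F' \<open>\<eta> > 0\<close>]
  show ?thesis
  proof eventually_elim
    case (elim x)
    define d where "d = x - xb"
    show ?case
    proof (intro ballI)
      fix g V assume g: "g \<in> {\<gamma>lo..\<gamma>hi}" and "V \<in> newton_maps F F' q g x"
      note g0 = \<gamma>_pos[OF g]
      obtain B where B: "B \<in> bouligand_subdiff (prox q g) (fwd g x)"
        and V: "V = (B o\<^sub>L (id_blinfun - (1 / g) *\<^sub>R F' x)) - id_blinfun"
        using \<open>V \<in> newton_maps F F' q g x\<close> by (auto simp: newton_maps_alt)
      define R where "R = F x - F xb - F' x d"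
      have res: "V d - prox_residual F q g x
          = (1 / g) *\<^sub>R B R - (prox q g (fwd g x) - xb - B (fwd g x - fwd g xb))"
      proof -
        have "fwd g x - fwd g xb = d - (1 / g) *\<^sub>R F' x d - (1 / g) *\<^sub>R R"
          by (simp add: fwd_def d_def R_def algebra_simps)
        then show ?thesis
          unfolding V prox_residual_def fwd_def[symmetric]
          by (simp add: blinfun.diff_left blinfun.diff_right blinfun.scaleR_left blinfun.scaleR_right
              d_def scaleR_diff_right)
      qed
      \<comment> \<open>The Newton map uses the derivative at \<open>x\<close>, so continuity of
        \<open>F'\<close> has to compensate for linearizing at \<open>xb\<close>.\<close>
      have "norm R \<le> norm (F x - F xb - F' xb d) + norm ((F' x - F' xb) d)"
        using norm_triangle_ineq4[of "F x - F xb - F' xb d" "(F' x - F' xb) d"]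
        by (simp add: R_def blinfun.diff_left)
      also have "norm ((F' x - F' xb) d) \<le> \<eta> * norm d"
        using elim(4) by (intro order_trans[OF norm_blinfun] mult_right_mono) auto
      also have "norm (F x - F xb - F' xb d) \<le> \<eta> * norm d" using elim(2) by (simp add: d_def)
      finally have R: "norm R \<le> 2 * \<eta> * norm d" by simp
      have "norm (B R) \<le> 1 * norm R"
        by (rule order_trans[OF norm_blinfun mult_right_mono[OF bouligand_prox_norm_le[OF g0 B]]]) simp
      with R have "norm (B R) \<le> 2 * \<eta> * norm d" by simp
      then have "(1 / g) * norm (B R) \<le> (1 / \<gamma>lo) * (2 * \<eta> * norm d)"
        using g \<gamma> by (intro mult_mono frac_le) auto
      also have "\<dots> = e / 2 * norm d" using \<gamma> by (simp add: \<eta>_def)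
      finally have 1: "norm ((1 / g) *\<^sub>R B R) \<le> e / 2 * norm d" using g0 by simp
      have "norm (F x - F xb) \<le> norm (F x - F xb - F' xb d) + norm (F' xb d)"
        using norm_triangle_ineq[of "F x - F xb - F' xb d" "F' xb d"] by simp
      also have "\<dots> \<le> norm d + norm (F' xb) * norm d"
        using elim(3) norm_blinfun[of "F' xb" d] by (simp add: d_def)
      finally have "(1 / \<gamma>lo) * norm (F x - F xb) \<le> (1 / \<gamma>lo) * ((norm (F' xb) + 1) * norm d)"
        using \<gamma> by (intro mult_left_mono) (auto simp: algebra_simps)
      then have "norm (fwd g x - fwd g xb) \<le> C * norm d"
        using norm_fwd_diff[OF g, of x] unfolding C_def d_def by (simp only: distrib_right mult_1 mult.assoc)
      then have "e / 2 / C * norm (fwd g x - fwd g xb) \<le> e / 2 / C * (C * norm d)"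
        using C assms by (intro mult_left_mono) auto
      also have "\<dots> = e / 2 * norm d" using C by simp
      finally have 2: "norm (prox q g (fwd g x) - xb - B (fwd g x - fwd g xb)) \<le> e / 2 * norm d"
        using elim(1) g B order_trans by blast
      have "norm (V d - prox_residual F q g x) \<le> e / 2 * norm d + e / 2 * norm d"
        unfolding res by (rule norm_triangle_le_diff[OF add_mono[OF 1 2]])
      then show "norm (V (x - xb) - prox_residual F q g x) \<le> e * norm (x - xb)" by (simp add: d_def)
    qed
  qed
qed

text \<open>By contradiction and compactness: failing lower bounds produce, in the limit, an SCD
  derivative of the sum map at \<open>(xb, 0)\<close> and a unit vector in the kernel of the
  corresponding Newton map, against regularity.\<close>

lemma eventually_newton_bounded_below:
  obtains c where "c > 0"
    and "\<forall>\<^sub>F x in nhds xb. \<forall>g\<in>{\<gamma>lo..\<gamma>hi}. \<forall>V\<in>newton_maps F F' q g x. \<forall>d. c * norm d \<le> norm (V d)"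
proof (rule ccontr)
  assume neg: "\<not> thesis"
  define s where "s = (\<lambda>k. inverse (real (Suc k)))"
  have s: "\<And>k. s k > 0" "s \<longlonglongrightarrow> 0" unfolding s_def by (simp, rule LIMSEQ_inverse_real_of_nat)
  \<comment> \<open>The same null sequence \<open>s\<close> controls all errors. The derivative
    \<open>D\<close> near \<open>B\<close> is recorded because SCD derivatives are limits of tangent
    spaces at points of differentiability.\<close>
  have "\<exists>x g B z' D d. dist x xb < s k \<and> g \<in> {\<gamma>lo..\<gamma>hi} \<and> B \<in> bouligand_subdiff (prox q g) (fwd g x)
     \<and> norm (((B o\<^sub>L (id_blinfun - (1 / g) *\<^sub>R F' x)) - id_blinfun) d) \<le> s k \<and> norm d = 1
     \<and> (prox q g has_derivative blinfun_apply D) (at z') \<and> dist z' (fwd g x) < s k \<and> dist D B < s k" for k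
  proof -
    have "\<not> (\<forall>\<^sub>F x in nhds xb. \<forall>g\<in>{\<gamma>lo..\<gamma>hi}. \<forall>V\<in>newton_maps F F' q g x. \<forall>d. s k * norm d \<le> norm (V d))"
      using neg that s(1) by blast
    then obtain x where x: "dist x xb < s k"
        "\<not> (\<forall>g\<in>{\<gamma>lo..\<gamma>hi}. \<forall>V\<in>newton_maps F F' q g x. \<forall>d. s k * norm d \<le> norm (V d))"
      unfolding eventually_nhds_metric using s(1)[of k] by blast
    then obtain g V d where g: "g \<in> {\<gamma>lo..\<gamma>hi}" and V: "V \<in> newton_maps F F' q g x"
      and d: "norm (blinfun_apply V d) < s k * norm d" by (auto simp: not_le)
    obtain B where B: "B \<in> bouligand_subdiff (prox q g) (fwd g x)"
      and VB: "V = (B o\<^sub>L (id_blinfun - (1 / g) *\<^sub>R F' x)) - id_blinfun"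
      using V by (auto simp: newton_maps_alt)
    obtain z' D where "(prox q g has_derivative blinfun_apply D) (at z')"
        "dist z' (fwd g x) < s k" "dist D B < s k"
      using bouligand_subdiff_approx[OF B s(1)] by blast
    moreover have "d \<noteq> 0" using d by auto
    then have "norm (sgn d) = 1" "norm (V (sgn d)) \<le> s k"
      using d by (auto simp: norm_sgn sgn_div_norm blinfun.scaleR_right field_simps)
    ultimately show ?thesis using x(1) g B VB by blast
  qed
  then obtain x g B z' D d where x: "\<And>k. dist (x k) xb < s k" and g: "\<And>k. g k \<in> {\<gamma>lo..\<gamma>hi}"
    and B: "\<And>k. B k \<in> bouligand_subdiff (prox q (g k)) (fwd (g k) (x k))"
    and small: "\<And>k. norm (((B k o\<^sub>L (id_blinfun - (1 / g k) *\<^sub>R F' (x k))) - id_blinfun) (d k)) \<le> s k"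
    and d: "\<And>k. norm (d k) = 1"
    and der: "\<And>k. (prox q (g k) has_derivative blinfun_apply (D k)) (at (z' k))"
    and z': "\<And>k. dist (z' k) (fwd (g k) (x k)) < s k" and DB: "\<And>k. dist (D k) (B k) < s k"
    by metis
  \<comment> \<open>Bundling parameter, operator and unit vector gives one bounded sequence, hence a
    common convergent subsequence.\<close>
  define Y where "Y = (\<lambda>k. (g k, B k, d k))"
  have "range Y \<subseteq> {\<gamma>lo..\<gamma>hi} \<times> cball 0 1 \<times> cball 0 1"
    using g d bouligand_prox_norm_le[OF \<gamma>_pos[OF g] B] by (auto simp: Y_def)
  then have "bounded (range Y)"
    by (rule bounded_subset[rotated]) (intro bounded_Times bounded_cball bounded_closed_interval)
  then obtain y r where r: "strict_mono r" and "(Y \<circ> r) \<longlonglongrightarrow> y"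
    using bounded_imp_convergent_subsequence by blast
  moreover obtain gl Bl dl where "y = (gl, Bl, dl)" by (cases y)
  ultimately have lim: "(\<lambda>k. (g (r k), B (r k), d (r k))) \<longlonglongrightarrow> (gl, Bl, dl)" by (simp add: Y_def o_def)
  have gl: "(\<lambda>k. g (r k)) \<longlonglongrightarrow> gl" using tendsto_fst[OF lim] by simp
  have Bl: "(\<lambda>k. B (r k)) \<longlonglongrightarrow> Bl" using tendsto_fst[OF tendsto_snd[OF lim]] by simp
  have dl: "(\<lambda>k. d (r k)) \<longlonglongrightarrow> dl" using tendsto_snd[OF tendsto_snd[OF lim]] by simp
  have sr: "(\<lambda>k. s (r k)) \<longlonglongrightarrow> 0" using LIMSEQ_subseq_LIMSEQ[OF s(2) r] by (simp add: o_def)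
  have "(\<lambda>k. dist (x (r k)) xb) \<longlonglongrightarrow> 0"
    by (rule tendsto_sandwich[OF _ _ tendsto_const sr]) (use x in \<open>auto intro!: always_eventually less_imp_le\<close>)
  then have xl: "(\<lambda>k. x (r k)) \<longlonglongrightarrow> xb" by (rule tendsto_dist_iff[THEN iffD2])
  have "(\<lambda>k. dist (D (r k)) (B (r k))) \<longlonglongrightarrow> 0"
    by (rule tendsto_sandwich[OF _ _ tendsto_const sr]) (use DB in \<open>auto intro!: always_eventually less_imp_le\<close>)
  then have "(\<lambda>k. D (r k) - B (r k)) \<longlonglongrightarrow> 0" by (simp add: dist_norm tendsto_norm_zero_iff)
  from tendsto_add[OF this Bl] have Dl: "(\<lambda>k. D (r k)) \<longlonglongrightarrow> Bl" by simp
  have "\<gamma>lo \<le> gl" using g by (intro LIMSEQ_le_const[OF gl]) auto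
  then have gl0: "gl > 0" using \<gamma> by simp
  have fwdl: "(\<lambda>k. fwd (g (r k)) (x (r k))) \<longlonglongrightarrow> fwd gl xb"
    unfolding fwd_def using gl0
    by (intro tendsto_intros xl gl isCont_tendsto_compose[OF isCont_F xl]) auto
  have "(\<lambda>k. dist (z' (r k)) (fwd (g (r k)) (x (r k)))) \<longlonglongrightarrow> 0"
    by (rule tendsto_sandwich[OF _ _ tendsto_const sr]) (use z' in \<open>auto intro!: always_eventually less_imp_le\<close>)
  then have "(\<lambda>k. z' (r k) - fwd (g (r k)) (x (r k))) \<longlonglongrightarrow> 0" by (simp add: dist_norm tendsto_norm_zero_iff)
  from tendsto_add[OF this fwdl] have z'l: "(\<lambda>k. z' (r k)) \<longlonglongrightarrow> fwd gl xb" by simp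
  \<comment> \<open>The parameter moves too. Since \<open>xb\<close> is the proximal point of
    \<open>fwd g xb\<close> for every positive \<open>g\<close>, nonexpansiveness with this moving
    reference point settles the limit.\<close>
  have pl: "(\<lambda>k. prox q (g (r k)) (z' (r k))) \<longlonglongrightarrow> xb"
  proof -
    have "(\<lambda>k. fwd (g (r k)) xb) \<longlonglongrightarrow> fwd gl xb"
      unfolding fwd_def using gl0 by (intro tendsto_intros gl) auto
    from tendsto_norm[OF tendsto_diff[OF z'l this]]
    have null: "(\<lambda>k. norm (z' (r k) - fwd (g (r k)) xb)) \<longlonglongrightarrow> 0" by simp
    have "norm (prox q (g (r k)) (z' (r k)) - xb) \<le> norm (z' (r k) - fwd (g (r k)) xb)" for k
      using prox_nonexpansive[OF \<gamma>_pos[OF g], of "r k" "z' (r k)" "fwd (g (r k)) xb"]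
      by (simp add: prox_fwd_sol[OF \<gamma>_pos[OF g]])
    from Lim_null_comparison[OF always_eventually[OF allI[OF this]] null]
    show ?thesis by (rule LIM_zero_cancel)
  qed
  have "(\<lambda>k. minty F q (g (r k)) (z' (r k))) \<longlonglongrightarrow> (xb, gl *\<^sub>R (fwd gl xb - xb) + F xb)"
    unfolding minty_def by (intro tendsto_intros pl gl z'l isCont_tendsto_compose[OF isCont_F pl])
  moreover have "gl *\<^sub>R (fwd gl xb - xb) + F xb = 0" using gl0 by (simp add: fwd_def)
  ultimately have "(\<lambda>k. minty F q (g (r k)) (z' (r k))) \<longlonglongrightarrow> (xb, 0)" by simp
  from scd_deriv_sum_map_limit[OF gl0 \<gamma>_pos[OF g] gl F isCont_F' der Dl this]
  have "adj_subspace (range (blinfun_apply (minty_deriv gl Bl (F' xb)))) \<in> scd_deriv (sum_map F q) (xb, 0)" .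
  then have "\<And>ys. (ys, 0) \<in> adj_subspace (range (blinfun_apply (minty_deriv gl Bl (F' xb)))) \<Longrightarrow> ys = 0"
    using reg unfolding scd_regular_def by blast
  moreover have "((Bl o\<^sub>L (id_blinfun - (1 / gl) *\<^sub>R F' xb)) - id_blinfun) dl = 0"
  proof -
    have "(\<lambda>k. norm (((B (r k) o\<^sub>L (id_blinfun - (1 / g (r k)) *\<^sub>R F' (x (r k)))) - id_blinfun) (d (r k))))
      \<longlonglongrightarrow> norm (((Bl o\<^sub>L (id_blinfun - (1 / gl) *\<^sub>R F' xb)) - id_blinfun) dl)"
      using gl0 by (intro tendsto_intros Bl gl dl isCont_tendsto_compose[OF isCont_F' xl]) auto
    from LIMSEQ_le[OF this sr] small show ?thesis by auto
  qed
  ultimately have "dl = 0" by (rule newton_map_kernel_trivial[OF gl0])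
  moreover have "norm dl = 1" using tendsto_norm[OF dl] d by (simp add: LIMSEQ_const_iff)
  ultimately show False by simp
qed

section \<open>Contraction, superlinear convergence and well-definedness of the steps\<close>

lemma prox_residual_eq_zero:
  assumes "g > 0" and "0 \<in> sum_map F q x"
  shows "prox_residual F q g x = 0"
proof -
  obtain v where v: "v \<in> subdiff q x" "F x + v = 0" using assms(2) by (auto simp: sum_map_def)
  then have "v = - F x" by (simp add: add_eq_0_iff)
  then show ?thesis using prox_eqI[OF assms(1) v(1)] by (simp add: prox_residual_def)
qed

text \<open>The two clauses together say that the algorithm works near \<open>xb\<close>: an
  infinite run converges superlinearly, and a run of finite length has either stopped at
  \<open>xb\<close> or can be continued, for every admissible choice, by a uniquely determined
  step.\<close>

lemma newton_locally_superlinear: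
  "\<exists>U. open U \<and> xb \<in> U \<and>
    (\<forall>N \<gamma> V x.
       x 0 \<in> U \<longrightarrow> newton_iterates F F' q N \<gamma> V x \<longrightarrow> (\<forall>k. enat k < N \<longrightarrow> \<gamma> k \<in> {\<gamma>lo..\<gamma>hi}) \<longrightarrow>
         (N = \<infinity> \<longrightarrow> converges_superlinearly x xb) \<and>
         (\<forall>K. N = enat K \<longrightarrow>
            (if 0 \<in> sum_map F q (x K) then x K = xb
             else \<forall>g\<in>{\<gamma>lo..\<gamma>hi}. newton_maps F F' q g (x K) \<noteq> {} \<and>
                    (\<forall>W\<in>newton_maps F F' q g (x K).
                       \<exists>!d. blinfun_apply W d = - prox_residual F q g (x K)))))"
proof -
  obtain c where c: "c > 0" and low: "\<forall>\<^sub>F x in nhds xb. \<forall>g\<in>{\<gamma>lo..\<gamma>hi}.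
      \<forall>V\<in>newton_maps F F' q g x. \<forall>d. c * norm d \<le> norm (V d)"
    by (rule eventually_newton_bounded_below)
  have "\<forall>\<^sub>F x in nhds xb. \<forall>g\<in>{\<gamma>lo..\<gamma>hi}. newton_maps F F' q g x \<noteq> {} \<and>
      (\<forall>V\<in>newton_maps F F' q g x. norm (V (x - xb) - prox_residual F q g x) \<le> c / 2 * norm (x - xb)
        \<and> (\<forall>d. c * norm d \<le> norm (V d)))"
    using low eventually_newton_residual[OF half_gt_zero[OF c]] eventually_newton_maps_nonempty
    by eventually_elim auto
  then obtain \<rho> where "\<rho> > 0"
    and near: "\<And>x. dist x xb < \<rho> \<Longrightarrow> \<forall>g\<in>{\<gamma>lo..\<gamma>hi}. newton_maps F F' q g x \<noteq> {} \<and>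
      (\<forall>V\<in>newton_maps F F' q g x. norm (V (x - xb) - prox_residual F q g x) \<le> c / 2 * norm (x - xb)
        \<and> (\<forall>d. c * norm d \<le> norm (V d)))"
    unfolding eventually_nhds_metric by blast
  have \<rho>: "newton_maps F F' q g x \<noteq> {}" if "x \<in> ball xb \<rho>" "g \<in> {\<gamma>lo..\<gamma>hi}" for x g
    using near[of x] that unfolding mem_ball dist_commute[of xb] by blast
  have \<rho>_res: "norm (V (x - xb) - prox_residual F q g x) \<le> c / 2 * norm (x - xb)"
    and \<rho>_low: "c * norm d \<le> norm (V d)"
    if "x \<in> ball xb \<rho>" "g \<in> {\<gamma>lo..\<gamma>hi}" "V \<in> newton_maps F F' q g x" for x g V d
    using near[of x] that unfolding mem_ball dist_commute[of xb] by blast+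
  \<comment> \<open>The Newton equation turns the map applied to the new error into the residual
    defect at the old point; the lower bound \<open>c\<close> then converts this into an error
    estimate.\<close>
  have step: "c * norm (x + d - xb) \<le> e * norm (x - xb)"
    if "x \<in> ball xb \<rho>" "g \<in> {\<gamma>lo..\<gamma>hi}" "V \<in> newton_maps F F' q g x"
      "V d = - prox_residual F q g x" "norm (V (x - xb) - prox_residual F q g x) \<le> e * norm (x - xb)"
    for x g V d e
  proof -
    have "V (x + d - xb) = V (x - xb) - prox_residual F q g x"
      using that(4) by (simp add: blinfun.add_right blinfun.diff_right)
    then show ?thesis using \<rho>_low[OF that(1-3), of "x + d - xb"] that(5) by simp
  qed
  show ?thesis
  proof (intro exI[of _ "ball xb \<rho>"] conjI allI impI)
    fix N \<gamma> V x
    assume x0: "x 0 \<in> ball xb \<rho>" and it: "newton_iterates F F' q N \<gamma> V x"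
      and \<gamma>_in: "\<forall>k. enat k < N \<longrightarrow> \<gamma> k \<in> {\<gamma>lo..\<gamma>hi}"
    have itk: "V k \<in> newton_maps F F' q (\<gamma> k) (x k)"
        "V k (x (Suc k) - x k) = - prox_residual F q (\<gamma> k) (x k)"
        "\<gamma> k \<in> {\<gamma>lo..\<gamma>hi}" if "enat k < N" for k
    proof -
      from it that have "V k \<in> newton_maps F F' q (\<gamma> k) (x k) \<and>
        (\<exists>d. V k d = - prox_residual F q (\<gamma> k) (x k) \<and> x (Suc k) = x k + d)"
        unfolding newton_iterates_def by blast
      then show "V k \<in> newton_maps F F' q (\<gamma> k) (x k)"
        "V k (x (Suc k) - x k) = - prox_residual F q (\<gamma> k) (x k)" by auto
      show "\<gamma> k \<in> {\<gamma>lo..\<gamma>hi}" using \<gamma>_in that by blast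
    qed
    have stepk: "c * norm (x (Suc k) - xb) \<le> e * norm (x k - xb)"
      if "enat k < N" "x k \<in> ball xb \<rho>"
        "norm (V k (x k - xb) - prox_residual F q (\<gamma> k) (x k)) \<le> e * norm (x k - xb)" for k e
      using step[OF that(2) itk(3,1,2)[OF that(1)] that(3)] by simp
    \<comment> \<open>Dividing the defect bound c/2 by the lower bound \<open>c\<close> gives the
      contraction factor 1/2, which keeps the iterates in the ball.\<close>
    have half: "norm (x (Suc k) - xb) \<le> 1 / 2 * norm (x k - xb)" if "enat k < N" "x k \<in> ball xb \<rho>" for k
      using stepk[OF that \<rho>_res[OF that(2) itk(3,1)[OF that(1)]]] c by (simp add: field_simps)
    \<comment> \<open>The index \<open>N\<close> itself is included: it is the last iterate produced
      by a finite run, at which stopping or continuing is decided.\<close>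
    have in_ball: "x k \<in> ball xb \<rho> \<and> norm (x k - xb) \<le> (1 / 2) ^ k * norm (x 0 - xb)" if "enat k \<le> N" for k
      using that
    proof (induction k)
      case (Suc k)
      then have lt: "enat k < N" by (metis Suc_ile_eq)
      with Suc.IH have IH: "x k \<in> ball xb \<rho>" "norm (x k - xb) \<le> (1 / 2) ^ k * norm (x 0 - xb)" by auto
      have "norm (x (Suc k) - xb) \<le> 1 / 2 * norm (x k - xb)" by (rule half[OF lt IH(1)])
      moreover from this have "norm (x (Suc k) - xb) \<le> norm (x k - xb)" by (rule order_trans) simp
      ultimately show ?case using IH by (auto simp: dist_norm norm_minus_commute)
    qed (use x0 in simp)
    show "converges_superlinearly x xb" if "N = \<infinity>"
    proof -
      have lt: "enat k < N" for k using that by simp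
      have ball: "x k \<in> ball xb \<rho>" and dec: "norm (x k - xb) \<le> (1 / 2) ^ k * norm (x 0 - xb)" for k
        using in_ball[of k] lt[of k] by auto
      have "(\<lambda>k. (1 / 2) ^ k * norm (x 0 - xb)) \<longlonglongrightarrow> 0 * norm (x 0 - xb)"
        by (intro tendsto_mult tendsto_const LIMSEQ_power_zero) simp
      then have "(\<lambda>k. (1 / 2) ^ k * norm (x 0 - xb)) \<longlonglongrightarrow> 0" by simp
      from Lim_null_comparison[OF always_eventually[OF allI[OF dec]] this]
      have lim: "x \<longlonglongrightarrow> xb" by (rule LIM_zero_cancel)
      have "(\<lambda>k. norm (x (Suc k) - xb)) \<in> o(\<lambda>k. norm (x k - xb))"
      proof (rule landau_o.smallI)
        \<comment> \<open>The residual estimate is used with \<open>c * e\<close>, so that division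
          by \<open>c\<close> leaves exactly \<open>e\<close>.\<close>
        fix e :: real assume "e > 0"
        then have "\<forall>\<^sub>F k in sequentially. \<forall>g\<in>{\<gamma>lo..\<gamma>hi}. \<forall>V\<in>newton_maps F F' q g (x k).
            norm (V (x k - xb) - prox_residual F q g (x k)) \<le> c * e * norm (x k - xb)"
          using eventually_compose_filterlim[OF eventually_newton_residual lim] c by simp
        then show "\<forall>\<^sub>F k in sequentially. norm (norm (x (Suc k) - xb)) \<le> e * norm (norm (x k - xb))"
        proof eventually_elim
          case (elim k)
          then have "c * norm (x (Suc k) - xb) \<le> c * e * norm (x k - xb)"
            by (intro stepk lt ball) (use itk[OF lt] in blast)
          then show ?case using c by (simp add: mult.assoc)
        qed
      qed
      with lim show ?thesis by (simp add: converges_superlinearly_def)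
    qed
    fix K assume K: "N = enat K"
    then have xK: "x K \<in> ball xb \<rho>" using in_ball by simp
    show "if 0 \<in> sum_map F q (x K) then x K = xb
       else \<forall>g\<in>{\<gamma>lo..\<gamma>hi}. newton_maps F F' q g (x K) \<noteq> {} \<and>
         (\<forall>W\<in>newton_maps F F' q g (x K). \<exists>!d. blinfun_apply W d = - prox_residual F q g (x K))"
    proof (cases "0 \<in> sum_map F q (x K)")
      case True
      \<comment> \<open>Any admissible parameter and Newton map show that \<open>xb\<close> is the
        only solution in the ball: the residual vanishes, so the lower bound \<open>c\<close> meets
        the upper bound c/2.\<close>
      have g: "\<gamma>lo \<in> {\<gamma>lo..\<gamma>hi}" using \<gamma> by simp
      obtain W where W: "W \<in> newton_maps F F' q \<gamma>lo (x K)" using \<rho>[OF xK g] by blast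
      have "norm (W (x K - xb)) \<le> c / 2 * norm (x K - xb)"
        using \<rho>_res[OF xK g W] prox_residual_eq_zero[OF \<gamma>_pos[OF g] True] by simp
      with \<rho>_low[OF xK g W, of "x K - xb"] have "c * norm (x K - xb) \<le> c / 2 * norm (x K - xb)" by linarith
      then have "norm (x K - xb) \<le> 0" using c by (simp add: field_simps)
      with True show ?thesis by simp
    next
      case False
      have "\<exists>!d. blinfun_apply W d = y" if "g \<in> {\<gamma>lo..\<gamma>hi}" "W \<in> newton_maps F F' q g (x K)" for g W y
      proof -
        have lin: "linear (blinfun_apply W)" by (simp add: bounded_linear.linear blinfun.bounded_linear_right)
        have inj: "inj (blinfun_apply W)"
        proof (rule injI)
          fix a b assume "W a = W b"
          then have "c * norm (a - b) \<le> 0" using \<rho>_low[OF xK that, of "a - b"] by (simp add: blinfun.diff_right)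
          then show "a = b" using c by (simp add: mult_le_0_iff)
        qed
        have "surj (blinfun_apply W)" by (rule linear_injective_imp_surjective[OF lin inj]) (rule refl)
        with inj have "bij (blinfun_apply W)" by (simp add: bij_def)
        then show ?thesis unfolding bij_iff by blast
      qed
      with False \<rho>[OF xK] show ?thesis by simp
    qed
  qed (use \<open>\<rho> > 0\<close> in auto)
qed

end

theorem proposition5p2:
  fixes F :: "real ^ 'n \<Rightarrow> real ^ 'n"
    and F' :: "real ^ 'n \<Rightarrow> (real ^ 'n) \<Rightarrow>\<^sub>L (real ^ 'n)"
    and q :: "real ^ 'n \<Rightarrow> ereal"
    and xb :: "real ^ 'n"
    and \<gamma>lo \<gamma>hi :: real
  assumes "\<And>x. (F has_derivative blinfun_apply (F' x)) (at x)"
    and "continuous_on UNIV F'"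
    and "closed_proper_convex q"
    and "0 \<in> sum_map F q xb"
    and "scd_semismooth (subdiff q) (xb, - F xb)"
    and "scd_regular (sum_map F q) (xb, 0)"
    and "0 < \<gamma>lo" "\<gamma>lo \<le> \<gamma>hi"
  shows "\<exists>U. open U \<and> xb \<in> U \<and>
    (\<forall>N \<gamma> V x.
       x 0 \<in> U \<longrightarrow> newton_iterates F F' q N \<gamma> V x \<longrightarrow> (\<forall>k. enat k < N \<longrightarrow> \<gamma> k \<in> {\<gamma>lo..\<gamma>hi}) \<longrightarrow>
         (N = \<infinity> \<longrightarrow> converges_superlinearly x xb) \<and>
         (\<forall>K. N = enat K \<longrightarrow>
            (if 0 \<in> sum_map F q (x K) then x K = xb
             else \<forall>g\<in>{\<gamma>lo..\<gamma>hi}. newton_maps F F' q g (x K) \<noteq> {} \<and>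
                    (\<forall>W\<in>newton_maps F F' q g (x K).
                       \<exists>!d. blinfun_apply W d = - prox_residual F q g (x K)))))"
proof -
  interpret newton_setting F F' q xb \<gamma>lo \<gamma>hi
    using assms by unfold_locales
  show ?thesis by (rule newton_locally_superlinear)
qed

end
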